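(* Let $N$ be a torsion-free nilpotent group of finite Prüfer rank, and let $\sigma$ be an endomorphism of $N$ with $\sigma(N)\,\Gamma_2(N)=N$. Then $\sigma\in\mathrm{Aut}(N)$.
   Context: For a group $N$, $\gamma_2(N)=[N,N]$ is the commutator subgroup and $\Gamma_2(N)$ is its isolator, i.e. the preimage in $N$ of the torsion subgroup of $N/\gamma_2(N)$. So $N/\Gamma_2(N)$ is the torsion-free abelianisation of $N$. *)

theory Defs
  imports "HOL-Algebra.Algebra"
begin

definition torsion_set :: "('a, 'b) monoid_scheme \<Rightarrow> 'a set" where
  "torsion_set G = {x \<in> carrier G. \<exists>n::nat. 0 < n \<and> x [^]\<^bsub>G\<^esub> n = \<one>\<^bsub>G\<^esub>}"

definition torsion_free_group :: "('a, 'b) monoid_scheme \<Rightarrow> bool" where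
  "torsion_free_group G \<longleftrightarrow> group G \<and> torsion_set G = {\<one>\<^bsub>G\<^esub>}"

definition commutator_subgroup :: "('a, 'b) monoid_scheme \<Rightarrow> 'a set \<Rightarrow> 'a set \<Rightarrow> 'a set" where
  "commutator_subgroup G H K =
     generate G (\<Union>h\<in>H. \<Union>k\<in>K. {h \<otimes>\<^bsub>G\<^esub> k \<otimes>\<^bsub>G\<^esub> (inv\<^bsub>G\<^esub> h) \<otimes>\<^bsub>G\<^esub> (inv\<^bsub>G\<^esub> k)})"

text \<open>The index is shifted by one: \<open>lower_central G i\<close> is \<open>\<gamma>\<close> with index \<open>i + 1\<close>.\<close>

primrec lower_central :: "('a, 'b) monoid_scheme \<Rightarrow> nat \<Rightarrow> 'a set" where
  "lower_central G 0 = carrier G"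
| "lower_central G (Suc i) = commutator_subgroup G (lower_central G i) (carrier G)"

definition nilpotent_group :: "('a, 'b) monoid_scheme \<Rightarrow> bool" where
  "nilpotent_group G \<longleftrightarrow> group G \<and> (\<exists>c. lower_central G c = {\<one>\<^bsub>G\<^esub>})"

text \<open>Finite Pruefer rank: there is a uniform bound \<open>r\<close> such that every finitely generated
  subgroup can be generated by at most \<open>r\<close> elements.\<close>

definition finite_pruefer_rank :: "('a, 'b) monoid_scheme \<Rightarrow> bool" where
  "finite_pruefer_rank G \<longleftrightarrow>
     (\<exists>r::nat. \<forall>S. finite S \<and> S \<subseteq> carrier G \<longrightarrow>
        (\<exists>T. finite T \<and> card T \<le> r \<and> T \<subseteq> carrier G \<and> generate G T = generate G S))"

definition gamma2 :: "('a, 'b) monoid_scheme \<Rightarrow> 'a set" where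
  "gamma2 G = derived G (carrier G)"

lemma lower_central_1: "lower_central G (Suc 0) = gamma2 G"
  by (simp add: commutator_subgroup_def gamma2_def derived_def)

text \<open>The preimage of the torsion subgroup under the projection \<open>x \<mapsto> gamma2 G #> x\<close>
  onto the abelianisation.\<close>

definition isolator2 :: "('a, 'b) monoid_scheme \<Rightarrow> 'a set" where
  "isolator2 G = {x \<in> carrier G. gamma2 G #>\<^bsub>G\<^esub> x \<in> torsion_set (G Mod gamma2 G)}"

end

theory Submission
  imports Defs
begin

text \<open>
  Put \<open>R 0 = N\<close> and let \<open>R (i + 1)\<close> be the set of elements of \<open>R i\<close> with a positive power in
  \<open>[R i, N]\<close>. These subgroups are \<open>\<sigma>\<close>-invariant, the factors \<open>R i / R (i + 1)\<close> are central and
  torsion-free, and the series reaches the trivial group since \<open>N\<close> modulo each term of its upper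
  central series is torsion-free. One shows by induction that \<open>\<sigma>\<close> is bijective modulo \<open>R i\<close>.
  As \<open>R i\<close> is central modulo \<open>R (i + 1)\<close>, bijectivity modulo \<open>R i\<close> implies that \<open>\<sigma>\<close> maps
  \<open>D = [R (i - 1), N]\<close> onto itself modulo \<open>R (i + 1)\<close>, and \<open>R i / D\<close> is torsion.
  This leaves a statement on a torsion-free abelian group \<open>A\<close> of finite rank with
  \<open>\<sigma> D = D\<close> and \<open>A / D\<close> torsion: \<open>\<sigma>\<close> is injective by a rank argument, hence injective on \<open>A / D\<close>,
  and it permutes the finite \<open>m\<close>-torsion subgroups of \<open>A / D\<close>, so it is surjective.
\<close>

subsection \<open>Abelian groups of finite rank\<close>

text \<open>Naming the bound lets the same \<open>r\<close> be carried to subgroups and quotients,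
  where it enters cardinality estimates.\<close>

definition pruefer_rank_le :: "('a, 'b) monoid_scheme \<Rightarrow> nat \<Rightarrow> bool" where
  "pruefer_rank_le G r \<longleftrightarrow>
     (\<forall>S. finite S \<and> S \<subseteq> carrier G \<longrightarrow>
        (\<exists>T. finite T \<and> card T \<le> r \<and> T \<subseteq> carrier G \<and> generate G T = generate G S))"

lemma finite_pruefer_rank_iff: "finite_pruefer_rank G \<longleftrightarrow> (\<exists>r. pruefer_rank_le G r)"
  by (simp add: finite_pruefer_rank_def pruefer_rank_le_def)

lemma pruefer_rank_leD:
  assumes "pruefer_rank_le G r" "finite S" "S \<subseteq> carrier G"
  obtains T where "finite T" "card T \<le> r" "T \<subseteq> carrier G" "generate G T = generate G S"
  using assms unfolding pruefer_rank_le_def by meson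

text \<open>A finite set in \<open>H\<close> lifts to a finite set in \<open>G\<close>, and the
  images of generators generate the image of the subgroup.\<close>

lemma pruefer_rank_le_surj_hom:
  assumes "group G" "group H" "h \<in> hom G H" "h ` carrier G = carrier H" "pruefer_rank_le G r"
  shows "pruefer_rank_le H r"
  unfolding pruefer_rank_le_def
proof (intro allI impI, elim conjE)
  interpret h: group_hom G H h
    using assms by (simp add: group_hom_def group_hom_axioms_def)
  fix S assume S: "finite S" "S \<subseteq> carrier H"
  then obtain S' where S': "finite S'" "S' \<subseteq> carrier G" "S = h ` S'"
    using assms(4) by (metis finite_subset_image)
  then obtain T where T: "finite T" "card T \<le> r" "T \<subseteq> carrier G" "generate G T = generate G S'"
    using pruefer_rank_leD[OF assms(5)] by blast
  have "generate H (h ` T) = generate H S"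
    using T S' by (metis h.generate_img)
  moreover have "card (h ` T) \<le> r"
    using T by (meson card_image_le le_trans)
  ultimately show "\<exists>T. finite T \<and> card T \<le> r \<and> T \<subseteq> carrier H \<and> generate H T = generate H S"
    using T by (metis h.hom_closed finite_imageI image_subsetI subsetD)
qed

text \<open>The small generating set found in \<open>G\<close> lies in the subgroup generated by
  \<open>S\<close>, hence already in \<open>H\<close>.\<close>

lemma pruefer_rank_le_subgroup:
  assumes "group G" "subgroup H G" "pruefer_rank_le G r"
  shows "pruefer_rank_le (G\<lparr>carrier := H\<rparr>) r"
  unfolding pruefer_rank_le_def
proof (intro allI impI, elim conjE)
  interpret group G by fact
  fix S assume S: "finite S" "S \<subseteq> carrier (G\<lparr>carrier := H\<rparr>)"
  have "H \<subseteq> carrier G" using assms(2) by (rule subgroup.subset)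
  then have "S \<subseteq> carrier G" using S by auto
  then obtain T where T: "finite T" "card T \<le> r" "T \<subseteq> carrier G" "generate G T = generate G S"
    by (rule pruefer_rank_leD[OF assms(3) S(1)])
  have "T \<subseteq> generate G S"
    using T(4) generate.incl[of _ T G] by blast
  also have "\<dots> \<subseteq> H"
    using S(2) assms(2) by (simp add: generate_subgroup_incl)
  finally have "T \<subseteq> H" .
  then show "\<exists>T. finite T \<and> card T \<le> r \<and> T \<subseteq> carrier (G\<lparr>carrier := H\<rparr>)
      \<and> generate (G\<lparr>carrier := H\<rparr>) T = generate (G\<lparr>carrier := H\<rparr>) S"
    using T S assms(2) generate_consistent[of _ H] by (intro exI[of _ T]) auto
qed

section \<open>Finiteness of the m-torsion of an abelian group of finite rank\<close>

lemma (in group) pow_mod_eq: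
  assumes "t \<in> carrier G" "t [^] (m::nat) = \<one>"
  shows "t [^] (j mod m) = t [^] (j::nat)"
proof -
  have "t [^] j = t [^] (m * (j div m) + j mod m)" by simp
  also have "\<dots> = (t [^] m) [^] (j div m) \<otimes> t [^] (j mod m)"
    by (simp only: nat_pow_mult[OF assms(1), symmetric] nat_pow_pow[OF assms(1)])
  finally show ?thesis using assms by simp
qed

text \<open>Exponents of \<open>t\<close> matter only modulo \<open>m\<close>, so adjoining
  \<open>t\<close> enlarges the subgroup by a factor of at most \<open>m\<close>. An inclusion
  suffices for an upper bound on the size.\<close>

lemma (in comm_group) generate_insert_torsion:
  assumes t: "t \<in> carrier G" "T \<subseteq> carrier G" "t [^] (m::nat) = \<one>" "0 < m"
  shows "generate G (insert t T) \<subseteq> (\<lambda>(j,y). t [^] j \<otimes> y) ` ({..<m} \<times> generate G T)"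
proof
  have sT: "generate G T \<subseteq> carrier G" using t(2) by (rule generate_incl)
  fix x assume "x \<in> generate G (insert t T)"
  \<comment> \<open>The exponent stays unbounded during the induction, so that products cause no
    trouble; it is reduced modulo \<open>m\<close> afterwards.\<close>
  then have "\<exists>j::nat. \<exists>y \<in> generate G T. x = t [^] j \<otimes> y"
  proof induction
    case one
    show ?case by (intro exI[of _ 0] bexI[of _ \<one>]) (auto intro: generate.one)
  next
    case (incl h)
    then show ?case
    proof
      assume "h = t"
      then show ?case using t by (intro exI[of _ 1] bexI[of _ \<one>]) (auto intro: generate.one)
    next
      assume "h \<in> T"
      then show ?case using t by (intro exI[of _ 0] bexI[of _ h]) (auto intro: generate.incl)
    qed
  next
    case (inv h)
    then show ?case
    proof
      assume "h = t"
      moreover have "inv t = t [^] (m - 1)"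
        using t by (metis Suc_diff_1 inv_equality nat_pow_Suc nat_pow_closed)
      ultimately show ?case
        using t by (intro exI[of _ "m - 1"] bexI[of _ \<one>]) (auto intro: generate.one)
    next
      assume "h \<in> T"
      then show ?case using t by (intro exI[of _ 0] bexI[of _ "inv h"]) (auto intro: generate.inv)
    qed
  next
    case (eng h1 h2)
    then obtain i j :: nat and y z where *: "y \<in> generate G T" "h1 = t [^] i \<otimes> y"
      "z \<in> generate G T" "h2 = t [^] j \<otimes> z" by blast
    then have "h1 \<otimes> h2 = t [^] (i + j) \<otimes> (y \<otimes> z)"
      using t sT by (auto simp: nat_pow_mult[symmetric] m_ac subset_iff)
    then show ?case using * by (blast intro: generate.eng)
  qed
  then obtain j :: nat and y where *: "y \<in> generate G T" "x = t [^] j \<otimes> y" by blast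
  then have "x = t [^] (j mod m) \<otimes> y" using pow_mod_eq t by simp
  then show "x \<in> (\<lambda>(j,y). t [^] j \<otimes> y) ` ({..<m} \<times> generate G T)"
    using * t by auto
qed

lemma (in comm_group) card_generate_torsion_le:
  assumes "finite T" "T \<subseteq> carrier G" "\<And>t. t \<in> T \<Longrightarrow> t [^] (m::nat) = \<one>" "0 < m"
  shows "finite (generate G T) \<and> card (generate G T) \<le> m ^ card T"
  using assms
proof (induction T)
  case empty
  then show ?case by (simp add: generate_empty)
next
  case (insert t T)
  let ?I = "(\<lambda>(j,y). t [^] j \<otimes> y) ` ({..<m} \<times> generate G T)"
  have IH: "finite (generate G T)" "card (generate G T) \<le> m ^ card T" using insert by auto
  have sub: "generate G (insert t T) \<subseteq> ?I"
    using insert by (intro generate_insert_torsion) auto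
  have fin: "finite ?I" using IH by simp
  have "card (generate G (insert t T)) \<le> card ?I" using sub fin by (rule card_mono[rotated])
  also have "\<dots> \<le> card ({..<m} \<times> generate G T)" using IH by (intro card_image_le) simp
  also have "\<dots> = m * card (generate G T)" by (simp add: card_cartesian_product)
  also have "\<dots> \<le> m ^ card (insert t T)" using insert IH by simp
  finally show ?case using sub fin finite_subset by blast
qed

lemma (in comm_group) subgroup_pow_kernel: "subgroup {x \<in> carrier G. x [^] (m::nat) = \<one>} G"
  by (rule subgroupI) (auto simp: nat_pow_inv nat_pow_distrib intro!: exI[of _ \<one>])

text \<open>A finite subset of the kernel generates a subgroup that needs at most \<open>r\<close>
  generators, and these lie in the kernel as well. So all finite subsets obey one common bound,
  which makes the kernel finite.\<close>

lemma (in comm_group) finite_pow_kernel: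
  assumes "pruefer_rank_le G r" "0 < m"
  shows "finite {x \<in> carrier G. x [^] (m::nat) = \<one>} \<and> card {x \<in> carrier G. x [^] m = \<one>} \<le> m ^ r"
proof (rule finite_if_finite_subsets_card_bdd)
  fix S assume S: "S \<subseteq> {x \<in> carrier G. x [^] m = \<one>}" "finite S"
  then have "S \<subseteq> carrier G" by auto
  then obtain T where T: "finite T" "card T \<le> r" "T \<subseteq> carrier G" "generate G T = generate G S"
    by (rule pruefer_rank_leD[OF assms(1) S(2)])
  have "T \<subseteq> generate G S" using T(4) generate.incl[of _ T G] by blast
  also have "\<dots> \<subseteq> {x \<in> carrier G. x [^] m = \<one>}"
    using S(1) subgroup_pow_kernel by (rule generate_subgroup_incl)
  finally have c: "finite (generate G T) \<and> card (generate G T) \<le> m ^ card T"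
    using T assms(2) by (intro card_generate_torsion_le) auto
  have "S \<subseteq> generate G T" using T(4) generate.incl[of _ S G] by blast
  then have "card S \<le> card (generate G T)" using c by (intro card_mono) auto
  also have "\<dots> \<le> m ^ card T" using c by simp
  also have "\<dots> \<le> m ^ r" using T(2) assms(2) by (intro power_increasing) auto
  finally show "card S \<le> m ^ r" .
qed

section \<open>Rank bounds the number of classes modulo squares\<close>

lemma (in group) rcos_eq_iff:
  assumes "subgroup H G" "x \<in> carrier G" "y \<in> carrier G"
  shows "H #> x = H #> y \<longleftrightarrow> x \<otimes> inv y \<in> H"
proof
  assume "H #> x = H #> y"
  then have "x \<in> H #> y" using rcos_self assms by metis
  then show "x \<otimes> inv y \<in> H" using subgroup.rcos_module_imp[OF assms(1) is_group assms(3)] by simp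
next
  assume "x \<otimes> inv y \<in> H"
  then have "x \<in> H #> y" using subgroup.rcos_module_rev[OF assms(1) is_group assms(3,2)] by simp
  then show "H #> x = H #> y" by (rule repr_independence[OF _ assms(3,1), symmetric])
qed

text \<open>
  A strictly increasing chain of isolated subgroups makes \<open>k 0, k 1, \<dots>\<close> independent, so \<open>B n\<close> modulo
  its squares has at least \<open>2 ^ n\<close> elements; rank \<open>r\<close> allows at most \<open>2 ^ r\<close>.
\<close>

lemma (in comm_group) exists_incongruent_mod_squares:
  fixes K :: "nat \<Rightarrow> 'a set" and k :: "nat \<Rightarrow> 'a"
  assumes K: "\<And>i. subgroup (K i) G" "\<And>i. K i \<subseteq> K (Suc i)"
    and k: "\<And>i. k i \<in> K (Suc i)" "\<And>i. k i \<notin> K i"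
    and iso: "\<And>i x m. x \<in> carrier G \<Longrightarrow> 0 < m \<Longrightarrow> x [^] (m::nat) \<in> K i \<Longrightarrow> x \<in> K i"
  defines "B \<equiv> \<lambda>n. generate G (k ` {..<n})"
  shows "\<exists>E. finite E \<and> card E = 2 ^ n \<and> E \<subseteq> B n \<and>
           (\<forall>x\<in>E. \<forall>y\<in>E. \<forall>b\<in>B n. x = y \<otimes> (b \<otimes> b) \<longrightarrow> x = y)"
proof (induction n)
  case 0
  show ?case by (intro exI[of _ "{\<one>}"]) (auto simp: B_def generate.one)
next
  case (Suc n)
  have kG: "k i \<in> carrier G" for i using K(1) k(1) subgroup.mem_carrier by metis
  have sB: "subgroup (B i) G" for i unfolding B_def using kG by (intro generate_is_subgroup) auto
  have BG: "x \<in> B i \<Longrightarrow> x \<in> carrier G" for x i using sB subgroup.mem_carrier by metis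
  note B = subgroup.m_closed[OF sB] subgroup.m_inv_closed[OF sB] subgroup.one_closed[OF sB]
  have "K i \<subseteq> K j" if "i \<le> j" for i j using K(2) that by (rule lift_Suc_mono_le)
  then have "k ` {..<n} \<subseteq> K n" using k(1) by (force simp: Suc_le_eq[symmetric])
  then have BK: "B n \<subseteq> K n" unfolding B_def using K(1) by (rule generate_subgroup_incl)
  \<comment> \<open>The element \<open>k n\<close> has infinite order modulo \<open>K n\<close>.
    Since \<open>iso\<close> speaks of natural exponents, the sign of \<open>p\<close> is removed
    first.\<close>
  have kpow0: "p = 0" if p: "k n [^] (p::int) \<in> K n" for p
  proof (rule ccontr)
    assume "p \<noteq> 0"
    have "k n [^] \<bar>p\<bar> \<in> K n"
    proof (cases "0 \<le> p")
      case False
      then have "\<bar>p\<bar> = - p" by simp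
      then show ?thesis using subgroup.m_inv_closed[OF K(1) p] by (simp only: int_pow_neg[OF kG])
    qed (use p in simp)
    then have "k n [^] (nat \<bar>p\<bar>) \<in> K n" using int_pow_int[of G "k n" "nat \<bar>p\<bar>"] by simp
    moreover have "0 < nat \<bar>p\<bar>" using \<open>p \<noteq> 0\<close> by simp
    ultimately have "k n \<in> K n" using iso kG by blast
    then show False using k(2) by blast
  qed
  \<comment> \<open>Uniqueness of the normal form \<open>k n [^] p \<otimes> u\<close>: comparing
    two of them puts a power of \<open>k n\<close> into \<open>B n\<close>, which lies in
    \<open>K n\<close>.\<close>
  have key: "p = q \<and> u = v"
    if "k n [^] (p::int) \<otimes> u = k n [^] q \<otimes> v" "u \<in> B n" "v \<in> B n" for p q u v
  proof -
    note uv = that(2,3)[THEN BG]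
    have "k n [^] (p - q) = inv (k n [^] q) \<otimes> (k n [^] p \<otimes> u) \<otimes> inv u"
      using kG uv m_comm[of "k n [^] p" "inv (k n [^] q)"] by (simp add: int_pow_diff m_assoc)
    also have "\<dots> = v \<otimes> inv u"
      unfolding that(1) using kG uv by (simp add: m_assoc[symmetric])
    finally have "k n [^] (p - q) \<in> K n" using that B BK by auto
    then have "p = q" using kpow0 by fastforce
    then show ?thesis using that(1) kG uv by simp
  qed
  have kB: "k i \<in> B n" if "i < n" for i unfolding B_def using that by (auto intro: generate.incl)
  have B_Suc: "B (Suc n) = generate G (insert (k n) (k ` {..<n}))"
    by (simp add: B_def lessThan_Suc)
  have kn_inv: "inv (k n) = k n [^] (- 1 :: int)"
    using int_pow_neg[OF kG, of n 1] kG by simp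
  \<comment> \<open>Existence of the normal form; integer exponents are required because
    \<open>k n\<close> has infinite order.\<close>
  have decomp: "\<exists>j::int. \<exists>c\<in>B n. b = k n [^] j \<otimes> c" if "b \<in> B (Suc n)" for b
    using that unfolding B_Suc
  proof induction
    case one
    have "\<one> = k n [^] (0::int) \<otimes> \<one>" by simp
    then show ?case using B(3) by blast
  next
    case (incl h)
    have "k n = k n [^] (1::int) \<otimes> \<one>" using kG by simp
    moreover have "h = k n [^] (0::int) \<otimes> h" if "h \<in> B n" using BG[OF that] by simp
    ultimately show ?case using incl kB B(3) by blast
  next
    case (inv h)
    have "inv (k n) = k n [^] (- 1 :: int) \<otimes> \<one>" using kG kn_inv by simp
    moreover have "inv h = k n [^] (0::int) \<otimes> inv h" if "h \<in> B n" using BG[OF that] by simp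
    ultimately show ?case using inv kB B(2,3) by blast
  next
    case (eng h1 h2)
    obtain i :: int and y where y: "y \<in> B n" "h1 = k n [^] i \<otimes> y" using eng.IH(1) by blast
    obtain j :: int and z where z: "z \<in> B n" "h2 = k n [^] j \<otimes> z" using eng.IH(2) by blast
    have "h1 \<otimes> h2 = k n [^] (i + j) \<otimes> (y \<otimes> z)"
      unfolding y(2) z(2) using kG BG[OF y(1)] BG[OF z(1)] by (simp add: int_pow_mult m_ac)
    then show ?case using B(1)[OF y(1) z(1)] by blast
  qed
  obtain E where E: "finite E" "card E = 2 ^ n" "E \<subseteq> B n"
    and EB: "\<And>x y b. \<lbrakk>x \<in> E; y \<in> E; b \<in> B n; x = y \<otimes> (b \<otimes> b)\<rbrakk> \<Longrightarrow> x = y"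
    using Suc.IH by blast
  \<comment> \<open>Every old representative is used twice, with exponent 0 and 1 of the new element
    \<open>k n\<close>, which doubles their number.\<close>
  define f where "f = (\<lambda>(p::int, e). k n [^] p \<otimes> e)"
  let ?E = "f ` ({0,1} \<times> E)"
  have inj: "inj_on f ({0,1} \<times> E)"
  proof (rule inj_onI)
    fix u v assume *: "u \<in> {0,1} \<times> E" "v \<in> {0,1} \<times> E" "f u = f v"
    have eq: "k n [^] fst u \<otimes> snd u = k n [^] fst v \<otimes> snd v"
      using *(3) by (simp add: f_def case_prod_beta)
    have "snd u \<in> B n" "snd v \<in> B n" using *(1,2) E(3) by auto
    from key[OF eq this] show "u = v" by (simp add: prod_eq_iff)
  qed
  have card: "card ?E = 2 ^ Suc n"
    using card_image[OF inj] E by (simp add: card_cartesian_product)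
  have sub: "?E \<subseteq> B (Suc n)"
  proof -
    have "k n \<in> B (Suc n)" unfolding B_Suc by (auto intro: generate.incl)
    moreover have "B n \<subseteq> B (Suc n)" unfolding B_def by (intro mono_generate) auto
    ultimately have "k n [^] p \<otimes> e \<in> B (Suc n)" if "e \<in> E" for p :: int and e
      using subsetD[OF E(3) that] by (intro B(1) subgroup_int_pow_closed[OF sB]) auto
    then show ?thesis unfolding f_def by auto
  qed
  have "x = y"
    if xy: "x \<in> ?E" "y \<in> ?E" and b: "b \<in> B (Suc n)" "x = y \<otimes> (b \<otimes> b)" for x y b
  proof -
    obtain p q e e' where x: "p \<in> {0,1::int}" "e \<in> E" "x = k n [^] p \<otimes> e"
      and y: "q \<in> {0,1::int}" "e' \<in> E" "y = k n [^] q \<otimes> e'"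
      using xy unfolding f_def by auto
    obtain j :: int and c where c: "c \<in> B n" "b = k n [^] j \<otimes> c" using decomp[OF b(1)] by blast
    have eB: "e \<in> B n" "e' \<in> B n" using x y E(3) by auto
    have jj: "k n [^] (q + (j + j)) = k n [^] q \<otimes> (k n [^] j \<otimes> k n [^] j)"
      by (simp only: int_pow_mult[OF kG])
    have "k n [^] p \<otimes> e = k n [^] (q + (j + j)) \<otimes> (e' \<otimes> (c \<otimes> c))"
      using b(2) kG BG[OF eB(1)] BG[OF eB(2)] BG[OF c(1)]
      unfolding x(3) y(3) c(2) jj by (simp add: m_ac)
    then have "p = q + (j + j) \<and> e = e' \<otimes> (c \<otimes> c)"
      by (rule key[OF _ eB(1) B(1)[OF eB(2) B(1)[OF c(1) c(1)]]])
    then have pq: "p = q + (j + j)" and "e = e' \<otimes> (c \<otimes> c)" by auto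
    then have "e = e'" using EB[OF x(2) y(2) c(1)] by blast
    \<comment> \<open>The exponents differ by an even number and both are 0 or 1.\<close>
    moreover have "p = 0 \<or> p = 1" "q = 0 \<or> q = 1" using x(1) y(1) by auto
    with pq have "p = q" by presburger
    ultimately show ?thesis using x(3) y(3) by simp
  qed
  then show ?case using card sub E(1) by (intro exI[of _ ?E] conjI ballI impI) blast+
qed

lemma (in comm_group) subgroup_squares:
  assumes "subgroup B G"
  shows "subgroup ((\<lambda>b. b \<otimes> b) ` B) G"
proof (rule subgroupI)
  note B = subgroup.m_closed[OF assms] subgroup.m_inv_closed[OF assms] subgroup.mem_carrier[OF assms]
  show "(\<lambda>b. b \<otimes> b) ` B \<subseteq> carrier G" using B by auto
  show "(\<lambda>b. b \<otimes> b) ` B \<noteq> {}" using subgroup.one_closed[OF assms] by auto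
  fix x assume "x \<in> (\<lambda>b. b \<otimes> b) ` B"
  then obtain a where a: "a \<in> B" "x = a \<otimes> a" by auto
  then have "inv x = inv a \<otimes> inv a" using B by (simp add: inv_mult_group)
  then show "inv x \<in> (\<lambda>b. b \<otimes> b) ` B" using a B by auto
  fix y assume "y \<in> (\<lambda>b. b \<otimes> b) ` B"
  then obtain b where b: "b \<in> B" "y = b \<otimes> b" by auto
  then have "x \<otimes> y = (a \<otimes> b) \<otimes> (a \<otimes> b)" using a B by (simp add: m_ac)
  then show "x \<otimes> y \<in> (\<lambda>b. b \<otimes> b) ` B" using a b B by auto
qed

lemma (in group) pruefer_rank_le_FactGroup:
  assumes "M \<lhd> G" "pruefer_rank_le G r"
  shows "pruefer_rank_le (G Mod M) r"
  using assms normal.factorgroup_is_group normal.r_coset_hom_Mod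
  by (intro pruefer_rank_le_surj_hom[of G "G Mod M" "\<lambda>x. M #> x"]) (auto simp: carrier_FactGroup)

text \<open>Powers of a nontrivial kernel element, pulled back along higher and higher powers of
  \<open>\<sigma>\<close>, would be independent. Already \<open>r + 1\<close> of them produce
  \<open>2 ^ (r + 1)\<close> classes modulo squares, whereas a quotient of rank \<open>r\<close> has
  at most \<open>2 ^ r\<close> elements of exponent 2.\<close>

lemma (in comm_group) endo_inj_if_cokernel_torsion:
  assumes tf: "\<And>x m. x \<in> carrier G \<Longrightarrow> 0 < m \<Longrightarrow> x [^] (m::nat) = \<one> \<Longrightarrow> x = \<one>"
    and rank: "pruefer_rank_le G r"
    and \<sigma>: "\<sigma> \<in> hom G G"
    and coker: "\<And>x. x \<in> carrier G \<Longrightarrow> \<exists>m>0. \<exists>y\<in>carrier G. x [^] (m::nat) = \<sigma> y"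
    and x: "x \<in> carrier G" "\<sigma> x = \<one>"
  shows "x = \<one>"
proof (rule ccontr)
  assume "x \<noteq> \<one>"
  have hom: "(\<sigma> ^^ i) \<in> hom G G" for i
    by (induction i) (use \<sigma> in \<open>auto simp: hom_def Pi_def\<close>)
  then have gh: "group_hom G G (\<sigma> ^^ i)" for i by (simp add: group_hom_def group_hom_axioms_def)
  note \<sigma>c = group_hom.hom_closed[OF gh]
  \<comment> \<open>The torsion cokernel is inherited by all powers of \<open>\<sigma>\<close>; the
    exponents multiply.\<close>
  have surj: "\<exists>m>0. \<exists>y\<in>carrier G. a [^] (m::nat) = (\<sigma> ^^ i) y" if "a \<in> carrier G" for a i
  proof (induction i)
    case 0
    show ?case using that by (intro exI[of _ 1]) auto
  next
    case (Suc i)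
    then obtain m y where y: "0 < m" "y \<in> carrier G" "a [^] (m::nat) = (\<sigma> ^^ i) y" by blast
    obtain m' z where z: "0 < m'" "z \<in> carrier G" "y [^] (m'::nat) = \<sigma> z" using coker[OF y(2)] by blast
    have "a [^] (m * m') = (\<sigma> ^^ Suc i) z"
      using y z that group_hom.hom_nat_pow[OF gh y(2), of i m']
      by (simp add: nat_pow_pow[symmetric] funpow_swap1)
    then show ?case using y z by (intro exI[of _ "m * m'"]) auto
  qed
  then obtain m k where k: "\<And>i. 0 < m i" "\<And>i. k i \<in> carrier G" "\<And>i. x [^] (m i :: nat) = (\<sigma> ^^ i) (k i)"
    using x(1) by metis
  txt \<open>A nontrivial kernel would make the kernels of the powers of \<open>\<sigma>\<close> strictly increasing.\<close>
  define K where "K i = {a \<in> carrier G. (\<sigma> ^^ i) a = \<one>}" for i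
  have sK: "subgroup (K i) G" for i
    using group_hom.subgroup_kernel[OF gh[of i]] by (simp add: K_def kernel_def)
  have K1: "K i \<subseteq> K (Suc i)" for i
    using group_hom.hom_one[OF gh[of 1]] by (auto simp: K_def)
  have K2: "k i \<in> K (Suc i)" for i
    using k(2) x group_hom.hom_nat_pow[OF gh[of 1] x(1), of "m i"] k(3)[of i] by (simp add: K_def)
  have K3: "k i \<notin> K i" for i
    using k(1)[of i] k(3)[of i] tf x(1) \<open>x \<noteq> \<one>\<close> by (auto simp: K_def)
  \<comment> \<open>Kernels of maps into a torsion-free group are isolated.\<close>
  have K4: "y \<in> K i" if "y \<in> carrier G" "0 < l" "y [^] (l::nat) \<in> K i" for i y l
    using that tf[OF \<sigma>c[OF that(1)] that(2)] group_hom.hom_nat_pow[OF gh that(1), of i l]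
    by (simp add: K_def)
  define B where "B = generate G (k ` {..<Suc r})"
  have "\<exists>E. finite E \<and> card E = 2 ^ Suc r \<and> E \<subseteq> B \<and>
           (\<forall>x\<in>E. \<forall>y\<in>E. \<forall>b\<in>B. x = y \<otimes> (b \<otimes> b) \<longrightarrow> x = y)"
    unfolding B_def
    by (rule exists_incongruent_mod_squares[where K = K])
      (rule sK K1 K2 K3 | rule K4; assumption)+
  then obtain E where E: "finite E" "card E = 2 ^ Suc r" "E \<subseteq> B"
    and EB: "\<And>x y b. \<lbrakk>x \<in> E; y \<in> E; b \<in> B; x = y \<otimes> (b \<otimes> b)\<rbrakk> \<Longrightarrow> x = y"
    by blast
  have sB: "subgroup B G" unfolding B_def using k(2) by (intro generate_is_subgroup) auto
  \<comment> \<open>Only squares of elements of \<open>B\<close> are factored out: this keeps the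
    elements of \<open>E\<close> apart, while their classes have order at most 2.\<close>
  define D where "D = (\<lambda>b. b \<otimes> b) ` B"
  have sD: "subgroup D G" unfolding D_def using sB by (rule subgroup_squares)
  have nD: "D \<lhd> G" using sD normal_iff_subgroup by blast
  interpret Q: comm_group "G Mod D" using sD by (rule abelian_FactGroup)
  have EG: "E \<subseteq> carrier G" using E(3) subgroup.subset[OF sB] by auto
  let ?T = "{q \<in> carrier (G Mod D). q [^]\<^bsub>G Mod D\<^esub> (2::nat) = \<one>\<^bsub>G Mod D\<^esub>}"
  have T: "finite ?T" "card ?T \<le> 2 ^ r"
    using Q.finite_pow_kernel[OF pruefer_rank_le_FactGroup[OF nD rank], of 2] by auto
  have "(\<lambda>x. D #> x) ` E \<subseteq> ?T"
  proof
    fix q assume "q \<in> (\<lambda>x. D #> x) ` E"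
    then obtain e where e: "e \<in> E" "q = D #> e" by auto
    then have eG: "e \<in> carrier G" using EG by auto
    have "e \<otimes> e \<in> D" using e E(3) by (auto simp: D_def)
    then have "q [^]\<^bsub>G Mod D\<^esub> (2::nat) = \<one>\<^bsub>G Mod D\<^esub>"
      using e(2) normal.FactGroup_pow[OF nD eG, of 2] subgroup.rcos_const[OF sD is_group] eG
      by (simp add: numeral_2_eq_2)
    then show "q \<in> ?T" using e eG by (auto simp: carrier_FactGroup)
  qed
  moreover have "inj_on (\<lambda>x. D #> x) E"
  proof (rule inj_onI)
    fix e e' assume e: "e \<in> E" "e' \<in> E" "D #> e = D #> e'"
    then have eG: "e \<in> carrier G" "e' \<in> carrier G" using EG by auto
    have "e \<otimes> inv e' \<in> D" using e eG rcos_eq_iff[OF sD] by blast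
    then obtain b where b: "b \<in> B" "e \<otimes> inv e' = b \<otimes> b" by (auto simp: D_def)
    have bG: "b \<in> carrier G" using subgroup.mem_carrier[OF sB b(1)] .
    have "e = (e \<otimes> inv e') \<otimes> e'" using eG by (simp add: m_assoc)
    also have "\<dots> = e' \<otimes> (b \<otimes> b)" unfolding b(2) using bG eG by (simp add: m_comm)
    finally show "e = e'" by (rule EB[OF e(1,2) b(1)])
  qed
  ultimately have "card E \<le> card ?T" using T(1) by (intro card_inj_on_le)
  then have "2 ^ Suc r \<le> (2::nat) ^ r" using T(2) E(2) by linarith
  then show False by simp
qed

text \<open>Invariance of \<open>H\<close> makes congruent elements have congruent images, so the
  universal property of the quotient provides the induced map.\<close>

lemma (in normal) endo_FactGroup:
  assumes "\<sigma> \<in> hom G G" "\<sigma> ` H \<subseteq> H"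
  obtains \<tau> where "\<tau> \<in> hom (G Mod H) (G Mod H)"
    and "\<And>x. x \<in> carrier G \<Longrightarrow> \<tau> (H #> x) = H #> \<sigma> x"
proof -
  interpret \<sigma>: group_hom G G \<sigma> using assms by (simp add: group_hom_def group_hom_axioms_def)
  have hom: "(\<lambda>x. H #> \<sigma> x) \<in> hom G (G Mod H)"
    using Group.hom_compose[OF assms(1) r_coset_hom_Mod] by (simp add: comp_def)
  have cong: "H #> \<sigma> x = H #> \<sigma> y"
    if xy: "x \<in> carrier G" "y \<in> carrier G" "H #> x = H #> y" for x y
  proof -
    have "x \<otimes> inv y \<in> H" using xy(3) unfolding rcos_eq_iff[OF subgroup_axioms xy(1,2)] .
    then have "\<sigma> (x \<otimes> inv y) \<in> H" using assms(2) by blast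
    then have "\<sigma> x \<otimes> inv \<sigma> y \<in> H" using xy(1,2) by simp
    then show ?thesis using rcos_eq_iff[OF subgroup_axioms] xy(1,2) by simp
  qed
  show thesis
  proof (rule FactGroup_universal[OF hom normal_axioms])
    fix \<tau> assume "\<tau> \<in> hom (G Mod H) (G Mod H)" "\<And>x. x \<in> carrier G \<Longrightarrow> \<tau> (H #> x) = H #> \<sigma> x"
    then show thesis by (rule that)
  next
    fix x y assume "x \<in> carrier G" "y \<in> carrier G" "H #> x = H #> y"
    then show "H #> \<sigma> x = H #> \<sigma> y" by (rule cong)
  qed
qed

text \<open>As \<open>\<sigma>\<close> maps \<open>D\<close> onto itself, torsion modulo
  \<open>D\<close> gives a torsion cokernel and thus injectivity. This descends to the quotient by
  \<open>D\<close>, which is a union of finite torsion layers, each permuted by the induced map.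
  Surjectivity then lifts back because \<open>D\<close> consists of images.\<close>

lemma (in comm_group) endo_iso_if_torsion_mod_fixed:
  assumes tf: "\<And>x m. x \<in> carrier G \<Longrightarrow> 0 < m \<Longrightarrow> x [^] (m::nat) = \<one> \<Longrightarrow> x = \<one>"
    and rank: "pruefer_rank_le G r"
    and \<sigma>: "\<sigma> \<in> hom G G"
    and D: "subgroup D G" "\<sigma> ` D = D"
    and tors: "\<And>x. x \<in> carrier G \<Longrightarrow> \<exists>m>0. x [^] (m::nat) \<in> D"
  shows "\<sigma> \<in> iso G G"
proof -
  interpret \<sigma>: group_hom G G \<sigma> using \<sigma> by (simp add: group_hom_def group_hom_axioms_def)
  have DG: "d \<in> D \<Longrightarrow> d \<in> carrier G" for d using D(1) by (rule subgroup.mem_carrier)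
  have coker: "\<exists>m>0. \<exists>y\<in>carrier G. x [^] (m::nat) = \<sigma> y" if x: "x \<in> carrier G" for x
  proof -
    obtain m :: nat where "0 < m" "x [^] m \<in> \<sigma> ` D" using tors[OF x] D(2) by auto
    then show ?thesis using DG by blast
  qed
  have inj: "x = \<one>" if "x \<in> carrier G" "\<sigma> x = \<one>" for x
    by (rule endo_inj_if_cokernel_torsion[OF tf rank \<sigma> coker that])
  interpret D: normal D G using D(1) normal_iff_subgroup by blast
  interpret Q: comm_group "G Mod D" using D(1) by (rule abelian_FactGroup)
  obtain \<tau> where \<tau>: "\<tau> \<in> hom (G Mod D) (G Mod D)"
    and \<tau>\<sigma>: "\<And>x. x \<in> carrier G \<Longrightarrow> \<tau> (D #> x) = D #> \<sigma> x"
    using D.endo_FactGroup[OF \<sigma> equalityD1[OF D(2)]] by blast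
  interpret \<tau>: group_hom "G Mod D" "G Mod D" \<tau> using \<tau> by (simp add: group_hom_def group_hom_axioms_def)
  \<comment> \<open>The kernel of the induced map is trivial: \<open>\<sigma> x\<close> in
    \<open>D\<close> equals some \<open>\<sigma> d\<close>, and injectivity forces
    \<open>x = d\<close>.\<close>
  have "q = D" if q: "q \<in> carrier (G Mod D)" "\<tau> q = D" for q
  proof -
    obtain x where x: "x \<in> carrier G" "q = D #> x" using q(1) by (auto simp: carrier_FactGroup)
    have "D #> \<sigma> x = D" using q(2) x \<tau>\<sigma> by simp
    then have "\<sigma> x \<in> D" by (rule coset_join1[OF _ _ D(1)]) (use x in simp)
    then obtain d where d: "d \<in> D" "\<sigma> x = \<sigma> d" using D(2) by blast
    then have "\<sigma> (x \<otimes> inv d) = \<one>" using x DG by simp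
    then have "x \<otimes> inv d = \<one>" using inj x DG[OF d(1)] by simp
    then have "x = d" using x(1) DG[OF d(1)] inv_equality[of x "inv d"] by simp
    then show ?thesis using d x D.rcos_const by simp
  qed
  then have inj\<tau>: "inj_on \<tau> (carrier (G Mod D))" by (simp add: \<tau>.inj_on_one_iff)
  \<comment> \<open>The quotient itself may be infinite. For positive \<open>m\<close> the layer
    \<open>F m\<close> is finite by the rank bound, so there injectivity implies
    surjectivity.\<close>
  define F where "F m = {q \<in> carrier (G Mod D). q [^]\<^bsub>G Mod D\<^esub> m = \<one>\<^bsub>G Mod D\<^esub>}" for m :: nat
  have "inj_on \<tau> (F m)" for m using inj\<tau> by (rule inj_on_subset) (auto simp: F_def)
  moreover have "\<tau> ` F m \<subseteq> F m" for m
  proof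
    fix p assume "p \<in> \<tau> ` F m"
    then obtain q where q: "q \<in> carrier (G Mod D)" "q [^]\<^bsub>G Mod D\<^esub> m = \<one>\<^bsub>G Mod D\<^esub>" "p = \<tau> q"
      unfolding F_def by blast
    then have "p [^]\<^bsub>G Mod D\<^esub> m = \<one>\<^bsub>G Mod D\<^esub>"
      using \<tau>.hom_nat_pow[OF q(1), of m] \<tau>.hom_one by simp
    then show "p \<in> F m" using q \<tau>.hom_closed unfolding F_def by simp
  qed
  moreover have "finite (F m)" if "0 < m" for m
    using Q.finite_pow_kernel[OF pruefer_rank_le_FactGroup[OF D.normal_axioms rank] that]
    unfolding F_def by blast
  ultimately have F: "\<tau> ` F m = F m" if "0 < m" for m using that by (simp add: endo_inj_surj)
  have "x \<in> \<sigma> ` carrier G" if x: "x \<in> carrier G" for x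
  proof -
    obtain m :: nat where m: "0 < m" "x [^] m \<in> D" using tors[OF x] by auto
    then have "(D #> x) [^]\<^bsub>G Mod D\<^esub> m = \<one>\<^bsub>G Mod D\<^esub>"
      using D.FactGroup_pow[OF x, of m] D.rcos_const[OF is_group] by simp
    then have "D #> x \<in> F m" using x by (simp add: F_def carrier_FactGroup)
    then have "D #> x \<in> \<tau> ` F m" using F[OF m(1)] by simp
    then obtain q where q: "q \<in> carrier (G Mod D)" "D #> x = \<tau> q" unfolding F_def by blast
    then obtain y where y: "y \<in> carrier G" "q = D #> y" unfolding carrier_FactGroup by blast
    then have "D #> x = D #> \<sigma> y" using q(2) \<tau>\<sigma> by simp
    \<comment> \<open>The error left by the lift \<open>y\<close> lies in \<open>D\<close>, hence is
      itself an image.\<close>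
    then have "x \<otimes> inv \<sigma> y \<in> \<sigma> ` D"
      using rcos_eq_iff[OF D(1) x \<sigma>.hom_closed[OF y(1)]] D(2) by simp
    then obtain d where d: "d \<in> D" "x \<otimes> inv \<sigma> y = \<sigma> d" by blast
    have "x = (x \<otimes> inv \<sigma> y) \<otimes> \<sigma> y" using x y by (simp add: m_assoc)
    also have "\<dots> = \<sigma> (d \<otimes> y)" using d y DG by simp
    finally show ?thesis by (rule image_eqI) (use DG[OF d(1)] y(1) in simp)
  qed
  then have "carrier G \<subseteq> \<sigma> ` carrier G" by (rule subsetI)
  then show ?thesis unfolding \<sigma>.iso_iff using inj by blast
qed

subsection \<open>Passing to a section\<close>

lemma r_coset_carrier_update [simp]: "S #>\<^bsub>G\<lparr>carrier := R\<rparr>\<^esub> x = S #>\<^bsub>G\<^esub> x"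
  by (simp add: r_coset_def)

lemma nat_pow_carrier_update: "x [^]\<^bsub>G\<lparr>carrier := R\<rparr>\<^esub> (m::nat) = x [^]\<^bsub>G\<^esub> m"
  by (simp add: nat_pow_def)

text \<open>The hypotheses make the section \<open>R\<close> modulo \<open>S\<close> a torsion-free
  abelian group of finite rank to which the abelian case applies. Bijectivity on this section and
  modulo \<open>R\<close> combine to bijectivity modulo \<open>S\<close>, as in the five
  lemma.\<close>

lemma (in group) endo_lift_section:
  assumes R: "R \<lhd> G" and S: "S \<lhd> G" and SR: "S \<subseteq> R"
    and comm: "\<And>x y. x \<in> R \<Longrightarrow> y \<in> R \<Longrightarrow> x \<otimes> y \<otimes> inv x \<otimes> inv y \<in> S"
    and tf: "\<And>x m. x \<in> R \<Longrightarrow> 0 < m \<Longrightarrow> x [^] (m::nat) \<in> S \<Longrightarrow> x \<in> S"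
    and rank: "pruefer_rank_le G r"
    and \<sigma>: "\<sigma> \<in> hom G G" "\<sigma> ` R \<subseteq> R" "\<sigma> ` S \<subseteq> S"
    and D: "subgroup D G" "D \<subseteq> R" "\<sigma> ` D \<subseteq> D"
      "\<And>d. d \<in> D \<Longrightarrow> \<exists>e\<in>D. d \<otimes> inv \<sigma> e \<in> S"
    and tors: "\<And>x. x \<in> R \<Longrightarrow> \<exists>m>0. x [^] (m::nat) \<in> D"
    and inj: "\<And>x. x \<in> carrier G \<Longrightarrow> \<sigma> x \<in> R \<Longrightarrow> x \<in> R"
    and surj: "\<And>x. x \<in> carrier G \<Longrightarrow> \<exists>y\<in>carrier G. x \<otimes> inv \<sigma> y \<in> R"
  shows "(\<forall>x\<in>carrier G. \<sigma> x \<in> S \<longrightarrow> x \<in> S) \<and> (\<forall>x\<in>carrier G. \<exists>y\<in>carrier G. x \<otimes> inv \<sigma> y \<in> S)"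
proof -
  interpret \<sigma>: group_hom G G \<sigma> using \<sigma>(1) by (simp add: group_hom_def group_hom_axioms_def)
  interpret R: normal R G by fact
  interpret S: normal S G by fact
  let ?R = "G\<lparr>carrier := R\<rparr>" and ?A = "G\<lparr>carrier := R\<rparr> Mod S"
  interpret RG: group ?R using R.subgroup_axioms by (rule subgroup_imp_group)
  have "S \<lhd> ?R"
    using R.subgroup_axioms S.normal_axioms SR by (rule normal_restrict_supergroup)
  then interpret SR: normal S ?R .
  have carA: "carrier ?A = (\<lambda>x. S #> x) ` R" by (simp add: carrier_FactGroup)
  have multA: "(S #> x) \<otimes>\<^bsub>?A\<^esub> (S #> y) = S #> (x \<otimes> y)" if "x \<in> R" "y \<in> R" for x y
    using SR.rcos_sum[of x y] that by simp
  interpret A: group ?A by (rule SR.factorgroup_is_group)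
  interpret A: comm_group ?A
  proof (rule A.group_comm_groupI)
    fix a b assume "a \<in> carrier ?A" "b \<in> carrier ?A"
    then obtain x y where x: "x \<in> R" "a = S #> x" and y: "y \<in> R" "b = S #> y" by (auto simp: carA)
    have "(x \<otimes> y) \<otimes> inv (y \<otimes> x) \<in> S" using comm[OF x(1) y(1)] x y by (simp add: inv_mult_group m_assoc)
    then have "S #> (x \<otimes> y) = S #> (y \<otimes> x)" using rcos_eq_iff[OF S.subgroup_axioms] x y by simp
    then show "a \<otimes>\<^bsub>?A\<^esub> b = b \<otimes>\<^bsub>?A\<^esub> a" unfolding x(2) y(2) using multA x y by simp
  qed
  have mem_S: "S #> x = S \<longleftrightarrow> x \<in> S" if "x \<in> R" for x
    using S.rcos_const[OF is_group] coset_join1[OF _ R.mem_carrier[OF that] S.subgroup_axioms] by auto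
  have tfA: "a = \<one>\<^bsub>?A\<^esub>" if a: "a \<in> carrier ?A" "0 < m" "a [^]\<^bsub>?A\<^esub> (m::nat) = \<one>\<^bsub>?A\<^esub>" for a m
  proof -
    obtain x where x: "x \<in> R" "a = S #> x" using a by (auto simp: carA)
    have "S #> x [^] m = S"
      using a(3) SR.FactGroup_pow[of x m] x(1) unfolding x(2) by (simp add: nat_pow_carrier_update)
    then have "x [^] m \<in> S" using x(1) by (intro coset_join1[OF _ _ S.subgroup_axioms]) auto
    then have "x \<in> S" by (rule tf[OF x(1) a(2)])
    then show ?thesis using mem_S[OF x(1)] x(2) by simp
  qed
  have "\<sigma> \<in> hom ?R ?R" using \<sigma> R.subset by (auto simp: hom_def Pi_def subset_iff)
  then obtain \<tau> where \<tau>: "\<tau> \<in> hom ?A ?A" "\<And>x. x \<in> R \<Longrightarrow> \<tau> (S #> x) = S #> \<sigma> x"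
    using SR.endo_FactGroup[of \<sigma>] \<sigma>(3) by auto
  have \<pi>: "group_hom ?R ?A (\<lambda>x. S #> x)"
    using SR.r_coset_hom_Mod by (simp add: group_hom_def group_hom_axioms_def)
  let ?D = "(\<lambda>x. S #> x) ` D"
  have "subgroup D ?R" using D R.subgroup_axioms by (simp add: subgroup_incl)
  then have DA: "subgroup ?D ?A" by (rule group_hom.subgroup_img_is_subgroup[OF \<pi>])
  \<comment> \<open>Elements of \<open>D\<close> are images of elements of \<open>D\<close> only
    modulo \<open>S\<close>; in the section this becomes an exact equality.\<close>
  have fixD: "\<tau> ` ?D = ?D"
  proof
    show "\<tau> ` ?D \<subseteq> ?D" using \<tau>(2) D(2,3) by (auto simp: subset_iff)
    show "?D \<subseteq> \<tau> ` ?D"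
    proof
      fix q assume "q \<in> ?D"
      then obtain d where d: "d \<in> D" "q = S #> d" by auto
      then obtain e where e: "e \<in> D" "d \<otimes> inv \<sigma> e \<in> S" using D(4) by blast
      then have "q = S #> \<sigma> e"
        using d rcos_eq_iff[OF S.subgroup_axioms] D(1) by (simp add: subgroup.mem_carrier)
      then show "q \<in> \<tau> ` ?D" using \<tau>(2) e D(2) by (auto simp: subset_iff)
    qed
  qed
  have torsD: "\<exists>m>0. a [^]\<^bsub>?A\<^esub> (m::nat) \<in> ?D" if a: "a \<in> carrier ?A" for a
  proof -
    obtain x where x: "x \<in> R" "a = S #> x" using a by (auto simp: carA)
    then obtain m :: nat where m: "0 < m" "x [^] m \<in> D" using tors by blast
    have "a [^]\<^bsub>?A\<^esub> m = S #> x [^] m"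
      using SR.FactGroup_pow[of x m] x(1) unfolding x(2) by (simp add: nat_pow_carrier_update)
    then show ?thesis using m by blast
  qed
  have "pruefer_rank_le ?R r"
    by (rule pruefer_rank_le_subgroup[OF is_group R.subgroup_axioms rank])
  then have rankA: "pruefer_rank_le ?A r"
    by (rule RG.pruefer_rank_le_FactGroup[OF SR.normal_axioms])
  have "\<tau> \<in> iso ?A ?A"
    by (rule A.endo_iso_if_torsion_mod_fixed[OF tfA rankA \<tau>(1) DA fixD torsD])
  then have bij: "bij_betw \<tau> (carrier ?A) (carrier ?A)" by (simp add: iso_def)
  have "x \<in> S" if x: "x \<in> carrier G" "\<sigma> x \<in> S" for x
  proof -
    have xR: "x \<in> R" by (rule inj[OF x(1) subsetD[OF SR x(2)]])
    have "group_hom ?A ?A \<tau>" using \<tau>(1) by (simp add: group_hom_def group_hom_axioms_def)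
    from group_hom.hom_one[OF this] have "\<tau> S = S" by simp
    moreover have "\<tau> (S #> x) = S" using \<tau>(2)[OF xR] S.rcos_const[OF is_group x(2)] by simp
    ultimately have eq: "\<tau> (S #> x) = \<tau> S" by simp
    have "S #> x \<in> carrier ?A" using xR by (simp add: carA)
    moreover have "S \<in> carrier ?A" using A.one_closed by simp
    ultimately have "S #> x = S" by (rule inj_onD[OF bij_betw_imp_inj_on[OF bij] eq])
    then show ?thesis using mem_S[OF xR] by simp
  qed
  \<comment> \<open>A preimage \<open>y\<close> modulo \<open>R\<close> leaves an error in
    \<open>R\<close>. The section supplies \<open>s\<close> in \<open>R\<close> that absorbs it, and
    \<open>s \<otimes> y\<close> is a preimage modulo \<open>S\<close>.\<close>
  moreover have "\<exists>y\<in>carrier G. x \<otimes> inv \<sigma> y \<in> S" if x: "x \<in> carrier G" for x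
  proof -
    obtain y where y: "y \<in> carrier G" "x \<otimes> inv \<sigma> y \<in> R" using surj[OF x] by blast
    have "S #> (x \<otimes> inv \<sigma> y) \<in> \<tau> ` carrier ?A"
      unfolding bij_betw_imp_surj_on[OF bij] unfolding carA using y(2) by (rule imageI)
    then obtain s where s: "s \<in> R" "S #> (x \<otimes> inv \<sigma> y) = \<tau> (S #> s)" unfolding carA by auto
    then have "S #> (x \<otimes> inv \<sigma> y) = S #> \<sigma> s" using \<tau>(2) by simp
    then have "(x \<otimes> inv \<sigma> y) \<otimes> inv \<sigma> s \<in> S"
      using rcos_eq_iff[OF S.subgroup_axioms] x y(1) s(1) by simp
    then have "x \<otimes> inv \<sigma> (s \<otimes> y) \<in> S" using x y(1) s(1) by (simp add: inv_mult_group m_assoc)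
    then show ?thesis using R.mem_carrier[OF s(1)] y(1) by (intro bexI[of _ "s \<otimes> y"]) auto
  qed
  ultimately show ?thesis by blast
qed

subsection \<open>Commutators and central series\<close>

text \<open>The convention agrees with the generators in \<open>commutator_subgroup\<close>; an
  abbreviation matches them syntactically.\<close>

abbreviation comm :: "('a, 'b) monoid_scheme \<Rightarrow> 'a \<Rightarrow> 'a \<Rightarrow> 'a" where
  "comm G x y \<equiv> x \<otimes>\<^bsub>G\<^esub> y \<otimes>\<^bsub>G\<^esub> inv\<^bsub>G\<^esub> x \<otimes>\<^bsub>G\<^esub> inv\<^bsub>G\<^esub> y"

lemma (in group) comm_eq: "x \<in> carrier G \<Longrightarrow> y \<in> carrier G \<Longrightarrow> comm G x y = (x \<otimes> y) \<otimes> inv (y \<otimes> x)"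
  by (simp add: inv_mult_group m_assoc)

lemma (in group) comm_mult:
  assumes "x \<in> carrier G" "y \<in> carrier G"
  shows "comm G x y \<otimes> (y \<otimes> x) = x \<otimes> y"
  unfolding comm_eq[OF assms] using assms by (simp only: m_assoc[OF m_closed inv_closed] m_closed l_inv r_one)

lemma (in group) comm_eqI:
  assumes "x \<in> carrier G" "y \<in> carrier G" "c \<in> carrier G" "x \<otimes> y = c \<otimes> (y \<otimes> x)"
  shows "comm G x y = c"
  using comm_mult[OF assms(1,2)] assms by (metis inv_closed m_closed right_cancel)

text \<open>Central factors can be moved anywhere, so both orders of multiplication change by the
  same factor. Hence a commutator depends only on its entries modulo the centre.\<close>

lemma (in group) comm_central_mult:
  assumes "x \<in> carrier G" "y \<in> carrier G" "a \<in> carrier G" "b \<in> carrier G"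
    and a: "\<And>z. z \<in> carrier G \<Longrightarrow> a \<otimes> z = z \<otimes> a" and b: "\<And>z. z \<in> carrier G \<Longrightarrow> b \<otimes> z = z \<otimes> b"
  shows "comm G (a \<otimes> x) (b \<otimes> y) = comm G x y"
proof (rule comm_eqI)
  let ?c = "comm G x y"
  have c: "?c \<in> carrier G" using assms by simp
  have "(a \<otimes> x) \<otimes> (b \<otimes> y) = a \<otimes> (x \<otimes> b) \<otimes> y" using assms(1-4) by (simp add: m_assoc)
  also have "\<dots> = a \<otimes> (b \<otimes> x) \<otimes> y" using b[OF assms(1)] by simp
  also have "\<dots> = (a \<otimes> b) \<otimes> (x \<otimes> y)" using assms(1-4) by (simp add: m_assoc)
  also have "\<dots> = (a \<otimes> b) \<otimes> (?c \<otimes> (y \<otimes> x))" using comm_mult[OF assms(1,2)] by simp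
  also have "\<dots> = (a \<otimes> (b \<otimes> ?c)) \<otimes> (y \<otimes> x)" using assms(1-4) c by (simp add: m_assoc)
  also have "\<dots> = (a \<otimes> (?c \<otimes> b)) \<otimes> (y \<otimes> x)" using b[OF c] by simp
  also have "\<dots> = (a \<otimes> (?c \<otimes> b \<otimes> y)) \<otimes> x" using assms(1-4) c by (simp add: m_assoc)
  also have "\<dots> = ((?c \<otimes> b \<otimes> y) \<otimes> a) \<otimes> x" using a[of "?c \<otimes> b \<otimes> y"] assms(2,4) c by simp
  also have "\<dots> = ?c \<otimes> ((b \<otimes> y) \<otimes> (a \<otimes> x))" using assms(1-4) c by (simp add: m_assoc)
  finally show "(a \<otimes> x) \<otimes> (b \<otimes> y) = ?c \<otimes> ((b \<otimes> y) \<otimes> (a \<otimes> x))" .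
qed (use assms(1-4) in auto)

text \<open>This is \<open>[x ^ n, y] = [x, y] ^ n\<close> for \<open>x\<close> commuting with
  \<open>c = [x, y]\<close>, written without inverses so that the induction merely moves
  factors.\<close>

lemma (in group) pow_commute_central:
  assumes "x \<in> carrier G" "y \<in> carrier G" "c \<in> carrier G"
    and "x \<otimes> y = c \<otimes> (y \<otimes> x)" "x \<otimes> c = c \<otimes> x"
  shows "x [^] (n::nat) \<otimes> y = c [^] n \<otimes> (y \<otimes> x [^] n)"
proof (induction n)
  case (Suc n)
  have xc: "x [^] n \<otimes> c = c \<otimes> x [^] n" using group_commutes_pow[OF assms(5,1,3)] .
  have "x [^] Suc n \<otimes> y = x [^] n \<otimes> (x \<otimes> y)" using assms(1-3) by (simp add: m_assoc)
  also have "\<dots> = (x [^] n \<otimes> c) \<otimes> (y \<otimes> x)" using assms by (simp add: m_assoc)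
  also have "\<dots> = c \<otimes> (x [^] n \<otimes> y) \<otimes> x" unfolding xc using assms(1-3) by (simp add: m_assoc)
  also have "\<dots> = c \<otimes> (c [^] n \<otimes> (y \<otimes> x [^] n)) \<otimes> x" unfolding Suc ..
  also have "\<dots> = (c \<otimes> c [^] n) \<otimes> (y \<otimes> (x [^] n \<otimes> x))" using assms(1-3) by (simp add: m_assoc)
  finally show ?case using nat_pow_Suc2[OF assms(3)] by simp
qed (use assms in simp)

section \<open>Translation between elements and their cosets modulo a normal subgroup\<close>

context normal
begin

interpretation Q: group "G Mod H"
  by (rule factorgroup_is_group)

lemma rcos_carrier: "x \<in> carrier G \<Longrightarrow> H #> x \<in> carrier (G Mod H)"
  by (simp add: carrier_FactGroup)

lemma rcos_mult:
  "x \<in> carrier G \<Longrightarrow> y \<in> carrier G \<Longrightarrow> (H #> x) \<otimes>\<^bsub>G Mod H\<^esub> (H #> y) = H #> (x \<otimes> y)"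
  by (simp add: rcos_sum)

lemma rcos_eq_H_iff: "x \<in> carrier G \<Longrightarrow> H #> x = H \<longleftrightarrow> x \<in> H"
  using rcos_const[OF is_group] coset_join1[OF _ _ subgroup_axioms] by blast

lemma rcos_hom: "group_hom G (G Mod H) (\<lambda>x. H #> x)"
  using r_coset_hom_Mod Q.is_group by (simp add: group_hom_def group_hom_axioms_def)

lemma rcos_inv_Mod: "x \<in> carrier G \<Longrightarrow> inv\<^bsub>G Mod H\<^esub> (H #> x) = H #> inv x"
  using group_hom.hom_inv[OF rcos_hom] by simp

lemma rcos_comm:
  assumes "x \<in> carrier G" "y \<in> carrier G"
  shows "comm (G Mod H) (H #> x) (H #> y) = H #> comm G x y"
  using assms rcos_inv_Mod by (simp add: rcos_sum)

lemma comm_mem_iff: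
  assumes "x \<in> carrier G" "y \<in> carrier G"
  shows "comm G x y \<in> H \<longleftrightarrow>
    (H #> x) \<otimes>\<^bsub>G Mod H\<^esub> (H #> y) = (H #> y) \<otimes>\<^bsub>G Mod H\<^esub> (H #> x)"
proof -
  have "comm G x y \<in> H \<longleftrightarrow> H #> (x \<otimes> y) = H #> (y \<otimes> x)"
    unfolding comm_eq[OF assms] using rcos_eq_iff[OF subgroup_axioms] assms by simp
  then show ?thesis using assms by (simp add: rcos_sum)
qed

lemma pow_mem_iff:
  assumes "x \<in> carrier G"
  shows "x [^] (n::nat) \<in> H \<longleftrightarrow> (H #> x) [^]\<^bsub>G Mod H\<^esub> n = \<one>\<^bsub>G Mod H\<^esub>"
  using rcos_eq_H_iff[of "x [^] n"] FactGroup_pow[OF assms, of n] assms by simp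

text \<open>The set is the preimage of the centre of the quotient, and all closure properties are
  verified there.\<close>

lemma central_mod_normal: "{x \<in> carrier G. \<forall>y\<in>carrier G. comm G x y \<in> H} \<lhd> G" (is "?Z \<lhd> G")
proof -
  have Z: "x \<in> ?Z \<longleftrightarrow> x \<in> carrier G \<and>
      (\<forall>q\<in>carrier (G Mod H). (H #> x) \<otimes>\<^bsub>G Mod H\<^esub> q = q \<otimes>\<^bsub>G Mod H\<^esub> (H #> x))" for x
    using comm_mem_iff[of x] unfolding carrier_FactGroup by auto
  show ?thesis
  proof (rule normal_invI[OF subgroupI])
    show "?Z \<subseteq> carrier G" by auto
    have "\<one> \<in> ?Z" unfolding Z using Q.r_one Q.l_one subset by (simp del: mult_FactGroup)
    then show "?Z \<noteq> {}" by blast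
  next
    fix x assume x: "x \<in> ?Z"
    then have xG: "x \<in> carrier G" by simp
    show "inv x \<in> ?Z" unfolding Z
    proof (intro conjI ballI)
      fix q assume q: "q \<in> carrier (G Mod H)"
      let ?p = "H #> x"
      have p: "?p \<in> carrier (G Mod H)" "?p \<otimes>\<^bsub>G Mod H\<^esub> q = q \<otimes>\<^bsub>G Mod H\<^esub> ?p"
        using x q xG rcos_carrier unfolding Z by auto
      have "inv\<^bsub>G Mod H\<^esub> ?p \<otimes>\<^bsub>G Mod H\<^esub> q = q \<otimes>\<^bsub>G Mod H\<^esub> inv\<^bsub>G Mod H\<^esub> ?p"
        using p q by (metis Q.inv_closed Q.inv_solve_left' Q.inv_solve_right Q.m_assoc Q.m_closed)
      then show "(H #> inv x) \<otimes>\<^bsub>G Mod H\<^esub> q = q \<otimes>\<^bsub>G Mod H\<^esub> (H #> inv x)"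
        unfolding rcos_inv_Mod[OF xG] .
    qed (use xG in simp)
  next
    fix x y assume x: "x \<in> ?Z" and y: "y \<in> ?Z"
    then have xG: "x \<in> carrier G" and yG: "y \<in> carrier G" by simp_all
    show "x \<otimes> y \<in> ?Z" unfolding Z
    proof (intro conjI ballI)
      fix q assume q: "q \<in> carrier (G Mod H)"
      let ?p = "H #> x" and ?r = "H #> y"
      have p: "?p \<in> carrier (G Mod H)" "?p \<otimes>\<^bsub>G Mod H\<^esub> q = q \<otimes>\<^bsub>G Mod H\<^esub> ?p"
        "?r \<in> carrier (G Mod H)" "?r \<otimes>\<^bsub>G Mod H\<^esub> q = q \<otimes>\<^bsub>G Mod H\<^esub> ?r"
        using x y q xG yG rcos_carrier unfolding Z by auto
      have "?p \<otimes>\<^bsub>G Mod H\<^esub> ?r \<otimes>\<^bsub>G Mod H\<^esub> q = q \<otimes>\<^bsub>G Mod H\<^esub> (?p \<otimes>\<^bsub>G Mod H\<^esub> ?r)"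
        using p q by (metis Q.m_assoc)
      then show "(H #> (x \<otimes> y)) \<otimes>\<^bsub>G Mod H\<^esub> q = q \<otimes>\<^bsub>G Mod H\<^esub> (H #> (x \<otimes> y))"
        unfolding rcos_mult[OF xG yG] .
    qed (use xG yG in simp)
  next
    fix x h assume x: "x \<in> carrier G" and h: "h \<in> ?Z"
    then have hG: "h \<in> carrier G" by simp
    have "x \<otimes> h \<otimes> inv x \<otimes> inv h \<in> H"
    proof -
      have "comm G h x \<in> H" using h x by blast
      then show ?thesis unfolding comm_mem_iff[OF hG x] comm_mem_iff[OF x hG] by (rule sym)
    qed
    then have "H #> (x \<otimes> h \<otimes> inv x) = H #> h"
      using rcos_eq_iff[OF subgroup_axioms] x hG by simp
    then show "x \<otimes> h \<otimes> inv x \<in> ?Z" using h x hG unfolding Z by simp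
  qed
qed

text \<open>The image of \<open>K\<close> in the quotient is central. So powers distribute over
  products, with exponent \<open>m * n\<close> serving two elements at once, and conjugation does
  not change the cosets of elements of \<open>K\<close>.\<close>

lemma root_closure_normal:
  assumes K: "K \<lhd> G" and comm: "\<And>x y. x \<in> K \<Longrightarrow> y \<in> carrier G \<Longrightarrow> comm G x y \<in> H"
  shows "{x \<in> K. \<exists>m>0. x [^] (m::nat) \<in> H} \<lhd> G" (is "?R \<lhd> G")
proof -
  interpret K: normal K G by fact
  have com: "(H #> x) \<otimes>\<^bsub>G Mod H\<^esub> (H #> y) = (H #> y) \<otimes>\<^bsub>G Mod H\<^esub> (H #> x)"
    if "x \<in> K" "y \<in> carrier G" for x y
    using comm[OF that] comm_mem_iff[OF K.mem_carrier[OF that(1)] that(2)] by (rule iffD1[rotated])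
  show ?thesis
  proof (rule normal_invI[OF subgroupI])
    show "?R \<subseteq> carrier G" by auto
    have "\<one> [^] (1::nat) \<in> H" by simp
    then show "?R \<noteq> {}" using K.one_closed by blast
  next
    fix x assume "x \<in> ?R"
    then obtain m :: nat where x: "x \<in> K" "0 < m" "x [^] m \<in> H" by blast
    then have "inv x [^] m \<in> H" using nat_pow_inv[OF K.mem_carrier[OF x(1)], of m] by simp
    then show "inv x \<in> ?R" using x by blast
  next
    fix x y assume "x \<in> ?R" "y \<in> ?R"
    then obtain m n :: nat where x: "x \<in> K" "0 < m" "x [^] m \<in> H" and y: "y \<in> K" "0 < n" "y [^] n \<in> H"
      by blast
    let ?p = "H #> x" and ?r = "H #> y"
    have pr: "?p \<in> carrier (G Mod H)" "?r \<in> carrier (G Mod H)" using x y rcos_carrier by auto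
    have one: "?p [^]\<^bsub>G Mod H\<^esub> m = \<one>\<^bsub>G Mod H\<^esub>" "?r [^]\<^bsub>G Mod H\<^esub> n = \<one>\<^bsub>G Mod H\<^esub>"
      using x y pow_mem_iff by auto
    have "?p [^]\<^bsub>G Mod H\<^esub> (m * n) = \<one>\<^bsub>G Mod H\<^esub>"
      using Q.nat_pow_pow[OF pr(1), of m n] one(1) Q.nat_pow_one by metis
    moreover have "?r [^]\<^bsub>G Mod H\<^esub> (m * n) = \<one>\<^bsub>G Mod H\<^esub>"
      using Q.nat_pow_pow[OF pr(2), of n m] one(2) Q.nat_pow_one by (metis mult.commute)
    ultimately have "(?p \<otimes>\<^bsub>G Mod H\<^esub> ?r) [^]\<^bsub>G Mod H\<^esub> (m * n) = \<one>\<^bsub>G Mod H\<^esub>"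
      using Q.pow_mult_distrib[OF com[OF x(1) K.mem_carrier[OF y(1)]] pr, of "m * n"] Q.r_one[OF Q.one_closed]
      by metis
    then have "(x \<otimes> y) [^] (m * n) \<in> H"
      using pow_mem_iff[of "x \<otimes> y" "m * n"] rcos_mult[of x y] x y by (metis K.mem_carrier m_closed)
    moreover have "0 < m * n" using x y by simp
    ultimately show "x \<otimes> y \<in> ?R" using K.m_closed[OF x(1) y(1)] by blast
  next
    fix g x assume g: "g \<in> carrier G" and "x \<in> ?R"
    then obtain m :: nat where x: "x \<in> K" "0 < m" "x [^] m \<in> H" by blast
    have xG: "x \<in> carrier G" using x by simp
    have "comm G g x \<in> H" using com[OF x(1) g] comm_mem_iff[OF g xG] by simp
    then have "H #> (g \<otimes> x \<otimes> inv g) = H #> x"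
      using rcos_eq_iff[OF subgroup_axioms] g xG by simp
    then have "(g \<otimes> x \<otimes> inv g) [^] m \<in> H"
      using pow_mem_iff[of "g \<otimes> x \<otimes> inv g" m] pow_mem_iff[OF xG, of m] x(3) g xG by simp
    then show "g \<otimes> x \<otimes> inv g \<in> ?R" using K.inv_op_closed2[OF g x(1)] x(2) by blast
  qed
qed

end

section \<open>The upper central series\<close>

primrec upper_central :: "('a, 'b) monoid_scheme \<Rightarrow> nat \<Rightarrow> 'a set" where
  "upper_central G 0 = {\<one>\<^bsub>G\<^esub>}"
| "upper_central G (Suc i) = {x \<in> carrier G. \<forall>y\<in>carrier G. comm G x y \<in> upper_central G i}"

lemma (in group) upper_central_normal: "upper_central G i \<lhd> G"
proof (induction i)
  case (Suc i)
  then show ?case unfolding upper_central.simps by (rule normal.central_mod_normal)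
qed (simp add: one_is_normal)

text \<open>The factors of the upper central series of a torsion-free group are torsion-free. In the
  step, a commutator of \<open>x\<close> lies one level below \<open>x\<close> and its
  \<open>m\<close>-th power one level lower still, so the induction hypothesis applies to the
  commutator in place of \<open>x\<close>.\<close>

lemma (in group) upper_central_root_closed_Suc:
  assumes tf: "torsion_free_group G"
  shows "x \<in> upper_central G (Suc i) \<Longrightarrow> 0 < m \<Longrightarrow> x [^] (m::nat) \<in> upper_central G i \<Longrightarrow>
    x \<in> upper_central G i"
proof (induction i arbitrary: x)
  case 0
  then have "x \<in> torsion_set G" unfolding torsion_set_def by auto
  then show ?case using tf unfolding torsion_free_group_def by simp
next
  case (Suc i)
  interpret Z: normal "upper_central G i" G by (rule upper_central_normal)
  let ?Q = "G Mod upper_central G i"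
  interpret Q: group ?Q by (rule Z.factorgroup_is_group)
  let ?\<pi> = "\<lambda>x. upper_central G i #> x"
  have xG: "x \<in> carrier G" using Suc.prems(1) by simp
  have central: "?\<pi> z \<otimes>\<^bsub>?Q\<^esub> ?\<pi> y = ?\<pi> y \<otimes>\<^bsub>?Q\<^esub> ?\<pi> z"
    if z: "z \<in> upper_central G (Suc i)" and y: "y \<in> carrier G" for y z
    by (rule iffD1[OF Z.comm_mem_iff]) (use z y in simp_all)
  have "comm G x y \<in> upper_central G i" if y: "y \<in> carrier G" for y
  proof (rule Suc.IH)
    let ?c = "comm G x y"
    have cG: "?c \<in> carrier G" using xG y by simp
    show c: "?c \<in> upper_central G (Suc i)" using Suc.prems(1) y by simp
    show "0 < m" by fact
    txt \<open>Modulo the \<open>i\<close>-th term \<open>[x, y]\<close> is central, so \<open>[x, y] ^ m = [x ^ m, y] = 1\<close>.\<close>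
    have "?\<pi> x \<otimes>\<^bsub>?Q\<^esub> ?\<pi> y = ?\<pi> ?c \<otimes>\<^bsub>?Q\<^esub> (?\<pi> y \<otimes>\<^bsub>?Q\<^esub> ?\<pi> x)"
      using comm_mult[OF xG y] Z.rcos_mult xG y cG by simp
    then have "?\<pi> x [^]\<^bsub>?Q\<^esub> m \<otimes>\<^bsub>?Q\<^esub> ?\<pi> y = ?\<pi> ?c [^]\<^bsub>?Q\<^esub> m \<otimes>\<^bsub>?Q\<^esub> (?\<pi> y \<otimes>\<^bsub>?Q\<^esub> ?\<pi> x [^]\<^bsub>?Q\<^esub> m)"
      by (intro Q.pow_commute_central Z.rcos_carrier xG y cG central[OF c xG, symmetric])
    moreover have "?\<pi> x [^]\<^bsub>?Q\<^esub> m \<otimes>\<^bsub>?Q\<^esub> ?\<pi> y = ?\<pi> y \<otimes>\<^bsub>?Q\<^esub> ?\<pi> x [^]\<^bsub>?Q\<^esub> m"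
      unfolding Z.FactGroup_pow[OF xG] by (rule central[OF Suc.prems(3) y])
    moreover have "?\<pi> y \<otimes>\<^bsub>?Q\<^esub> ?\<pi> x [^]\<^bsub>?Q\<^esub> m \<in> carrier ?Q"
      by (intro Q.m_closed Q.nat_pow_closed Z.rcos_carrier xG y)
    ultimately have "?\<pi> ?c [^]\<^bsub>?Q\<^esub> m = \<one>\<^bsub>?Q\<^esub>"
      using Q.r_cancel_one'[OF _ Q.nat_pow_closed[OF Z.rcos_carrier[OF cG]]] by metis
    then show "?c [^] m \<in> upper_central G i" by (rule iffD2[OF Z.pow_mem_iff[OF cG]])
  qed
  then show ?case using xG by simp
qed

section \<open>Commutator subgroups and the lower central series\<close>

lemma (in group) commutator_subgroup_normal:
  assumes "H \<lhd> G"
  shows "commutator_subgroup G H (carrier G) \<lhd> G"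
  unfolding commutator_subgroup_def
proof (rule normal_generateI)
  interpret H: normal H G by fact
  show "(\<Union>h\<in>H. \<Union>k\<in>carrier G. {comm G h k}) \<subseteq> carrier G" by auto
  fix c g assume "c \<in> (\<Union>h\<in>H. \<Union>k\<in>carrier G. {comm G h k})" and g: "g \<in> carrier G"
  then obtain h k where h: "h \<in> H" "k \<in> carrier G" "c = comm G h k" by auto
  have hG: "h \<in> carrier G" using h by simp
  let ?h = "g \<otimes> h \<otimes> inv g" and ?k = "g \<otimes> k \<otimes> inv g"
  have cancel: "inv g \<otimes> (g \<otimes> z) = z" if "z \<in> carrier G" for z
    using g that by (simp add: m_assoc[symmetric])
  \<comment> \<open>Conjugating a generator conjugates both entries, and normality keeps the first
    one in \<open>H\<close>.\<close>
  have "g \<otimes> c \<otimes> inv g = comm G ?h ?k"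
    unfolding h(3) using g hG h(2) by (simp add: m_assoc inv_mult_group cancel)
  moreover have "?h \<in> H" by (rule H.inv_op_closed2[OF g h(1)])
  ultimately show "g \<otimes> c \<otimes> inv g \<in> (\<Union>h\<in>H. \<Union>k\<in>carrier G. {comm G h k})"
    using g h(2) by blast
qed

lemma comm_mem_commutator_subgroup:
  "h \<in> H \<Longrightarrow> k \<in> K \<Longrightarrow> comm G h k \<in> commutator_subgroup G H K"
  unfolding commutator_subgroup_def by (rule generate.incl) blast

lemma (in group) commutator_subgroup_leI:
  assumes "subgroup M G" "\<And>h k. h \<in> H \<Longrightarrow> k \<in> K \<Longrightarrow> comm G h k \<in> M"
  shows "commutator_subgroup G H K \<subseteq> M"
  unfolding commutator_subgroup_def
  by (rule generate_subgroup_incl[OF _ assms(1)]) (use assms(2) in auto)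

lemma (in group) commutator_subgroup_subset:
  assumes "H \<lhd> G"
  shows "commutator_subgroup G H (carrier G) \<subseteq> H"
proof (rule commutator_subgroup_leI)
  interpret H: normal H G by fact
  show "subgroup H G" by (rule H.subgroup_axioms)
  fix h k assume h: "h \<in> H" "k \<in> carrier G"
  then have "h \<otimes> (k \<otimes> inv h \<otimes> inv k) \<in> H"
    by (intro H.m_closed H.inv_op_closed2 H.m_inv_closed)
  then show "comm G h k \<in> H" using h by (simp add: m_assoc)
qed

lemma (in group_hom) hom_comm:
  "x \<in> carrier G \<Longrightarrow> y \<in> carrier G \<Longrightarrow> h (comm G x y) = comm H (h x) (h y)"
  by simp

lemma (in group) commutator_subgroup_endo:
  assumes "\<sigma> \<in> hom G G" "H \<subseteq> carrier G" "\<sigma> ` H \<subseteq> H"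
  shows "\<sigma> ` commutator_subgroup G H (carrier G) \<subseteq> commutator_subgroup G H (carrier G)"
proof -
  interpret \<sigma>: group_hom G G \<sigma> using assms by (simp add: group_hom_def group_hom_axioms_def)
  let ?C = "\<Union>h\<in>H. \<Union>k\<in>carrier G. {comm G h k}"
  have CG: "?C \<subseteq> carrier G" using assms(2) by (auto simp: subset_iff)
  have "\<sigma> ` ?C \<subseteq> ?C"
  proof
    fix c assume "c \<in> \<sigma> ` ?C"
    then obtain h k where h: "h \<in> H" "k \<in> carrier G" "c = \<sigma> (comm G h k)" by auto
    have "c = comm G (\<sigma> h) (\<sigma> k)" unfolding h(3) using h(2) subsetD[OF assms(2) h(1)] by simp
    moreover have "\<sigma> h \<in> H" using assms(3) h(1) by (rule subsetD[OF _ imageI])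
    moreover have "\<sigma> k \<in> carrier G" using h(2) by simp
    ultimately show "c \<in> ?C" by blast
  qed
  then have "generate G (\<sigma> ` ?C) \<subseteq> generate G ?C" by (rule mono_generate)
  then show ?thesis unfolding commutator_subgroup_def \<sigma>.generate_img[OF CG] .
qed

lemma (in group) lower_central_normal: "lower_central G i \<lhd> G"
proof (induction i)
  case 0
  show ?case by (rule normal_invI) (auto simp: subgroup_self)
next
  case (Suc i)
  then show ?case unfolding lower_central.simps by (rule commutator_subgroup_normal)
qed

text \<open>The induction climbs from the trivial term. For \<open>j = c\<close> the left side is
  \<open>lower_central G 0\<close>, the whole group, so the upper central series reaches the group
  after \<open>c\<close> steps.\<close>

lemma (in group) lower_central_le_upper_central:
  assumes "lower_central G c = {\<one>}"
  shows "j \<le> c \<Longrightarrow> lower_central G (c - j) \<subseteq> upper_central G j"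
proof (induction j)
  case 0
  then show ?case using assms by simp
next
  case (Suc j)
  \<comment> \<open>The bound \<open>Suc j \<le> c\<close> keeps the truncated subtraction
    exact.\<close>
  then have Sj: "Suc (c - Suc j) = c - j" by simp
  show ?case
  proof
    fix x assume x: "x \<in> lower_central G (c - Suc j)"
    interpret L: normal "lower_central G (c - Suc j)" G by (rule lower_central_normal)
    have "comm G x y \<in> upper_central G j" if "y \<in> carrier G" for y
    proof -
      have "comm G x y \<in> lower_central G (Suc (c - Suc j))"
        unfolding lower_central.simps by (rule comm_mem_commutator_subgroup[OF x that])
      then show ?thesis using Suc unfolding Sj by auto
    qed
    then show "x \<in> upper_central G (Suc j)" using x by simp
  qed
qed

text \<open>The series \<open>R\<close> of the overview. Commutators with the whole group make each
  factor central, the added roots make it torsion-free; the term with index 1 is the isolator of the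
  commutator subgroup.\<close>

primrec isolated_central :: "('a, 'b) monoid_scheme \<Rightarrow> nat \<Rightarrow> 'a set" where
  "isolated_central G 0 = carrier G"
| "isolated_central G (Suc i) = {x \<in> isolated_central G i. \<exists>m>0.
     x [^]\<^bsub>G\<^esub> (m::nat) \<in> commutator_subgroup G (isolated_central G i) (carrier G)}"

lemma (in group) isolated_central_normal: "isolated_central G i \<lhd> G"
proof (induction i)
  case 0
  show ?case by (rule normal_invI) (auto simp: subgroup_self)
next
  case (Suc i)
  show ?case unfolding isolated_central.simps
    using commutator_subgroup_normal[OF Suc] Suc comm_mem_commutator_subgroup
    by (rule normal.root_closure_normal)
qed

lemma (in group) commutator_subgroup_isolated_central_le:
  "commutator_subgroup G (isolated_central G i) (carrier G) \<subseteq> isolated_central G (Suc i)"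
proof
  fix x assume x: "x \<in> commutator_subgroup G (isolated_central G i) (carrier G)"
  have "x \<in> isolated_central G i"
    using commutator_subgroup_subset[OF isolated_central_normal] x by (rule subsetD)
  moreover from this have "x \<in> carrier G"
    by (rule subgroup.mem_carrier[OF normal_imp_subgroup[OF isolated_central_normal]])
  then have "x [^] (1::nat) \<in> commutator_subgroup G (isolated_central G i) (carrier G)" using x by simp
  ultimately show "x \<in> isolated_central G (Suc i)" unfolding isolated_central.simps by blast
qed

text \<open>Torsion-freeness of the factors: a root of a root is a root for the product of the
  exponents.\<close>

lemma (in group) isolated_central_root_closed:
  assumes x: "x \<in> isolated_central G i" "0 < m" "x [^] (m::nat) \<in> isolated_central G (Suc i)"
  shows "x \<in> isolated_central G (Suc i)"
proof -
  have xG: "x \<in> carrier G"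
    by (rule subgroup.mem_carrier[OF normal_imp_subgroup[OF isolated_central_normal] x(1)])
  obtain l :: nat where l: "0 < l" "(x [^] m) [^] l \<in> commutator_subgroup G (isolated_central G i) (carrier G)"
    using x(3) by auto
  then have "x [^] (m * l) \<in> commutator_subgroup G (isolated_central G i) (carrier G)"
    using nat_pow_pow[OF xG] by simp
  moreover have "0 < m * l" using x l by simp
  ultimately show ?thesis using x(1) unfolding isolated_central.simps by blast
qed

lemma (in group) isolated_central_endo:
  assumes "\<sigma> \<in> hom G G"
  shows "\<sigma> ` isolated_central G i \<subseteq> isolated_central G i"
proof (induction i)
  case 0
  show ?case using assms by (auto simp: hom_def)
next
  case (Suc i)
  interpret \<sigma>: group_hom G G \<sigma> using assms by (simp add: group_hom_def group_hom_axioms_def)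
  interpret R: normal "isolated_central G i" G by (rule isolated_central_normal)
  have K: "\<sigma> ` commutator_subgroup G (isolated_central G i) (carrier G)
      \<subseteq> commutator_subgroup G (isolated_central G i) (carrier G)"
    by (rule commutator_subgroup_endo[OF assms R.subset Suc])
  show ?case
  proof
    fix y assume "y \<in> \<sigma> ` isolated_central G (Suc i)"
    then obtain x and m :: nat where x: "y = \<sigma> x" "x \<in> isolated_central G i" "0 < m"
      "x [^] m \<in> commutator_subgroup G (isolated_central G i) (carrier G)" by auto
    have "y \<in> isolated_central G i" unfolding x(1) by (rule subsetD[OF Suc imageI[OF x(2)]])
    moreover have "y [^] m = \<sigma> (x [^] m)" unfolding x(1) using \<sigma>.hom_nat_pow R.mem_carrier[OF x(2)] by simp
    then have "y [^] m \<in> commutator_subgroup G (isolated_central G i) (carrier G)"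
      using subsetD[OF K imageI[OF x(4)]] by simp
    ultimately show "y \<in> isolated_central G (Suc i)" using x(3) unfolding isolated_central.simps by blast
  qed
qed

text \<open>Commutators with the group descend one step in the upper central series, and taking
  roots does not climb back because its factors are torsion-free. For \<open>i = c\<close> the bound
  is the trivial subgroup.\<close>

lemma (in group) isolated_central_le_upper_central:
  assumes "torsion_free_group G" "upper_central G c = carrier G"
  shows "isolated_central G i \<subseteq> upper_central G (c - i)"
proof (induction i)
  case 0
  show ?case using assms by simp
next
  case (Suc i)
  have sub: "isolated_central G (Suc i) \<subseteq> isolated_central G i" by auto
  show ?case
  proof (cases "c - i")
    \<comment> \<open>By truncated subtraction the bound is already trivial and stays so.\<close>
    case 0
    then show ?thesis using Suc sub by auto
  next
    case (Suc j)
    then have j: "c - Suc i = j" by simp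
    have le: "isolated_central G i \<subseteq> upper_central G (Suc j)" using \<open>isolated_central G i \<subseteq> upper_central G (c - i)\<close> Suc by simp
    have "commutator_subgroup G (isolated_central G i) (carrier G) \<subseteq> upper_central G j"
    proof (rule commutator_subgroup_leI)
      show "subgroup (upper_central G j) G" by (rule normal_imp_subgroup[OF upper_central_normal])
      fix h k assume h: "h \<in> isolated_central G i" and k: "k \<in> carrier G"
      show "comm G h k \<in> upper_central G j" using subsetD[OF le h] k by simp
    qed
    then show ?thesis unfolding j
      using upper_central_root_closed_Suc[OF assms(1), of _ j] le by (auto simp del: upper_central.simps)
  qed
qed

subsection \<open>Bijectivity modulo the terms of the series\<close>

declare isolated_central.simps(2) [simp del]

lemma (in group) isolated_central_Suc_subset: "isolated_central G (Suc i) \<subseteq> isolated_central G i"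
  by (auto simp: isolated_central.simps)

text \<open>Converts the hypothesis on \<open>isolator2\<close> into surjectivity modulo the term
  with index 1.\<close>

lemma (in group) isolator2_subset_isolated_central:
  "isolator2 G \<subseteq> isolated_central G (Suc 0)"
proof
  fix x assume x: "x \<in> isolator2 G"
  interpret N: normal "gamma2 G" G
    using lower_central_normal[of "Suc 0"] unfolding lower_central_1 .
  have xG: "x \<in> carrier G" using x unfolding isolator2_def by simp
  obtain m :: nat where m: "0 < m" "(gamma2 G #> x) [^]\<^bsub>G Mod gamma2 G\<^esub> m = \<one>\<^bsub>G Mod gamma2 G\<^esub>"
    using x unfolding isolator2_def torsion_set_def by auto
  from m(2) have "x [^] m \<in> gamma2 G" by (rule iffD2[OF N.pow_mem_iff[OF xG]])
  then show "x \<in> isolated_central G (Suc 0)"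
    using xG m(1) unfolding lower_central_1[symmetric] by (auto simp: isolated_central.simps)
qed

text \<open>For a normal \<open>\<sigma>\<close>-invariant \<open>M\<close> this is bijectivity of
  the induced map on the quotient by \<open>M\<close>, spelled out on elements so that no induced
  map has to be carried along.\<close>

definition (in group) endo_bij_mod :: "('a \<Rightarrow> 'a) \<Rightarrow> 'a set \<Rightarrow> bool" where
  "endo_bij_mod \<sigma> M \<longleftrightarrow> (\<forall>x\<in>carrier G. \<sigma> x \<in> M \<longrightarrow> x \<in> M) \<and>
     (\<forall>x\<in>carrier G. \<exists>y\<in>carrier G. x \<otimes> inv \<sigma> y \<in> M)"

lemma (in group) endo_bij_mod_inj:
  "endo_bij_mod \<sigma> M \<Longrightarrow> x \<in> carrier G \<Longrightarrow> \<sigma> x \<in> M \<Longrightarrow> x \<in> M"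
  unfolding endo_bij_mod_def by simp

lemma (in group) endo_bij_mod_surj:
  assumes "endo_bij_mod \<sigma> M" "x \<in> carrier G"
  obtains y where "y \<in> carrier G" "x \<otimes> inv \<sigma> y \<in> M"
  using assms unfolding endo_bij_mod_def by auto

text \<open>Specialises \<open>endo_lift_section\<close> to two consecutive terms. \<open>D\<close>
  remains a parameter: the first stage takes the whole group, later stages a commutator
  subgroup.\<close>

lemma (in group) endo_bij_mod_isolated_central_Suc:
  assumes rank: "pruefer_rank_le G r" and \<sigma>: "\<sigma> \<in> hom G G"
    and D: "subgroup D G" "D \<subseteq> isolated_central G i" "\<sigma> ` D \<subseteq> D"
      "\<And>d. d \<in> D \<Longrightarrow> \<exists>e\<in>D. d \<otimes> inv \<sigma> e \<in> isolated_central G (Suc i)"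
    and tors: "\<And>x. x \<in> isolated_central G i \<Longrightarrow> \<exists>m>0. x [^] (m::nat) \<in> D"
    and bij: "endo_bij_mod \<sigma> (isolated_central G i)"
  shows "endo_bij_mod \<sigma> (isolated_central G (Suc i))"
  unfolding endo_bij_mod_def
proof (rule endo_lift_section[where R = "isolated_central G i" and D = D])
  interpret R: normal "isolated_central G i" G by (rule isolated_central_normal)
  show "isolated_central G (Suc i) \<subseteq> isolated_central G i" by (rule isolated_central_Suc_subset)
  show "comm G x y \<in> isolated_central G (Suc i)"
    if "x \<in> isolated_central G i" "y \<in> isolated_central G i" for x y
    using comm_mem_commutator_subgroup[OF that(1) R.mem_carrier[OF that(2)]]
    by (rule subsetD[OF commutator_subgroup_isolated_central_le])
  show "x \<in> isolated_central G i" if "x \<in> carrier G" "\<sigma> x \<in> isolated_central G i" for x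
    using bij that unfolding endo_bij_mod_def by simp
  show "\<exists>y\<in>carrier G. x \<otimes> inv \<sigma> y \<in> isolated_central G i" if "x \<in> carrier G" for x
    using bij that unfolding endo_bij_mod_def by simp
  show "x \<in> isolated_central G (Suc i)"
    if "x \<in> isolated_central G i" "0 < m" "x [^] (m::nat) \<in> isolated_central G (Suc i)" for x m
    using that by (rule isolated_central_root_closed)
qed (fact isolated_central_normal isolated_central_endo[OF \<sigma>] rank \<sigma> D tors)+

text \<open>The term with index \<open>i + 1\<close> is central modulo the one with index
  \<open>i + 2\<close>. So modulo the latter a commutator depends only on its entries modulo the
  former, where both entries can be replaced by images under \<open>\<sigma>\<close>.\<close>

lemma (in group) commutator_subgroup_isolated_central_fixed:
  assumes \<sigma>: "\<sigma> \<in> hom G G"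
    and bij: "endo_bij_mod \<sigma> (isolated_central G i)" "endo_bij_mod \<sigma> (isolated_central G (Suc i))"
    and d: "d \<in> commutator_subgroup G (isolated_central G i) (carrier G)"
  shows "\<exists>e\<in>commutator_subgroup G (isolated_central G i) (carrier G).
    d \<otimes> inv \<sigma> e \<in> isolated_central G (Suc (Suc i))"
proof -
  interpret \<sigma>: group_hom G G \<sigma> using \<sigma> by (simp add: group_hom_def group_hom_axioms_def)
  let ?R = "isolated_central G i" and ?R' = "isolated_central G (Suc i)" and ?S = "isolated_central G (Suc (Suc i))"
  let ?K = "commutator_subgroup G ?R (carrier G)"
  interpret R: normal ?R G by (rule isolated_central_normal)
  interpret R': normal ?R' G by (rule isolated_central_normal)
  interpret S: normal ?S G by (rule isolated_central_normal)
  interpret K: normal ?K G by (rule commutator_subgroup_normal[OF R.normal_axioms])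
  interpret Q: group "G Mod ?S" by (rule S.factorgroup_is_group)
  let ?\<pi> = "\<lambda>x. ?S #> x"
  have R'R: "?R' \<subseteq> ?R" by (rule isolated_central_Suc_subset)
  have central: "?\<pi> u \<otimes>\<^bsub>G Mod ?S\<^esub> q = q \<otimes>\<^bsub>G Mod ?S\<^esub> ?\<pi> u"
    if u: "u \<in> ?R'" and q: "q \<in> carrier (G Mod ?S)" for u q
  proof -
    obtain y where y: "y \<in> carrier G" "q = ?\<pi> y" using q unfolding carrier_FactGroup by auto
    have "comm G u y \<in> ?S"
      using comm_mem_commutator_subgroup[OF u y(1)]
      by (rule subsetD[OF commutator_subgroup_isolated_central_le])
    then show ?thesis unfolding y(2) by (rule iffD1[OF S.comm_mem_iff[OF R'.mem_carrier[OF u] y(1)]])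
  qed
  have gen: "\<exists>e\<in>?K. ?\<pi> (comm G r x) = ?\<pi> (\<sigma> e)" if r: "r \<in> ?R" and x: "x \<in> carrier G" for r x
  proof -
    have rG: "r \<in> carrier G" using r by (rule R.mem_carrier)
    obtain s where s: "s \<in> carrier G" "r \<otimes> inv \<sigma> s \<in> ?R'"
      by (rule endo_bij_mod_surj[OF bij(2) rG])
    obtain y where y: "y \<in> carrier G" "x \<otimes> inv \<sigma> y \<in> ?R'"
      by (rule endo_bij_mod_surj[OF bij(2) x])
    define u where "u = r \<otimes> inv \<sigma> s"
    define v where "v = x \<otimes> inv \<sigma> y"
    have u: "u \<in> ?R'" "u \<in> carrier G" "r = u \<otimes> \<sigma> s"
      using s rG unfolding u_def by (simp_all add: m_assoc)
    have v: "v \<in> ?R'" "v \<in> carrier G" "x = v \<otimes> \<sigma> y"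
      using y x unfolding v_def by (simp_all add: m_assoc)
    \<comment> \<open>For the commutator of \<open>s\<close> and \<open>y\<close> to lie in
      \<open>?K\<close>, the preimage \<open>s\<close> must lie in \<open>?R\<close>; this follows
      from injectivity modulo \<open>?R\<close>.\<close>
    have "\<sigma> s = inv u \<otimes> r" unfolding u(3) using u(2) s(1) by (simp add: m_assoc[symmetric])
    moreover have "inv u \<otimes> r \<in> ?R"
      by (rule R.m_closed[OF R.m_inv_closed[OF subsetD[OF R'R u(1)]] r])
    ultimately have "\<sigma> s \<in> ?R" by simp
    then have "s \<in> ?R" by (rule endo_bij_mod_inj[OF bij(1) s(1)])
    then have sy: "comm G s y \<in> ?K" using y(1) by (rule comm_mem_commutator_subgroup)
    have c: "\<sigma> s \<in> carrier G" "\<sigma> y \<in> carrier G" using s(1) y(1) by auto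
    have "?\<pi> (comm G r x) = comm (G Mod ?S) (?\<pi> r) (?\<pi> x)"
      by (rule S.rcos_comm[OF rG x, symmetric])
    also have "\<dots> = comm (G Mod ?S) (?\<pi> u \<otimes>\<^bsub>G Mod ?S\<^esub> ?\<pi> (\<sigma> s)) (?\<pi> v \<otimes>\<^bsub>G Mod ?S\<^esub> ?\<pi> (\<sigma> y))"
      using S.rcos_mult[OF u(2) c(1)] S.rcos_mult[OF v(2) c(2)] unfolding u(3) v(3) by simp
    also have "\<dots> = comm (G Mod ?S) (?\<pi> (\<sigma> s)) (?\<pi> (\<sigma> y))"
      by (rule Q.comm_central_mult[OF S.rcos_carrier[OF c(1)] S.rcos_carrier[OF c(2)]
            S.rcos_carrier[OF u(2)] S.rcos_carrier[OF v(2)] central[OF u(1)] central[OF v(1)]])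
    also have "\<dots> = ?\<pi> (comm G (\<sigma> s) (\<sigma> y))" by (rule S.rcos_comm[OF c])
    also have "\<dots> = ?\<pi> (\<sigma> (comm G s y))" using \<sigma>.hom_comm[OF s(1) y(1)] by simp
    finally show ?thesis using sy by (rule bexI)
  qed
  \<comment> \<open>The elements congruent to an image of \<open>?K\<close> form a subgroup, so it
    is enough to treat the generating commutators.\<close>
  let ?E = "{d \<in> carrier G. \<exists>e\<in>?K. ?\<pi> d = ?\<pi> (\<sigma> e)}"
  have "subgroup ?E G"
  proof (rule subgroupI)
    show "?E \<subseteq> carrier G" by auto
    have "?\<pi> \<one> = ?\<pi> (\<sigma> \<one>)" by simp
    then show "?E \<noteq> {}" using K.one_closed by (auto intro!: exI[of _ \<one>] bexI[of _ \<one>])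
  next
    fix a assume "a \<in> ?E"
    then obtain e where a: "a \<in> carrier G" "e \<in> ?K" "?\<pi> a = ?\<pi> (\<sigma> e)" by auto
    have eG: "e \<in> carrier G" using a(2) by (rule K.mem_carrier)
    have "?\<pi> (inv a) = ?\<pi> (\<sigma> (inv e))"
      using S.rcos_inv_Mod[OF a(1)] S.rcos_inv_Mod[OF \<sigma>.hom_closed[OF eG]] a(3) eG by simp
    then have "\<exists>e\<in>?K. ?\<pi> (inv a) = ?\<pi> (\<sigma> e)" using K.m_inv_closed[OF a(2)] by (rule bexI)
    then show "inv a \<in> ?E" using a(1) by simp
  next
    fix a b assume "a \<in> ?E" "b \<in> ?E"
    then obtain e f where a: "a \<in> carrier G" "e \<in> ?K" "?\<pi> a = ?\<pi> (\<sigma> e)"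
      and b: "b \<in> carrier G" "f \<in> ?K" "?\<pi> b = ?\<pi> (\<sigma> f)" by auto
    have ef: "e \<in> carrier G" "f \<in> carrier G" using a(2) b(2) by (auto intro: K.mem_carrier)
    have "?\<pi> (a \<otimes> b) = ?\<pi> (\<sigma> (e \<otimes> f))"
      using S.rcos_mult[OF a(1) b(1)] S.rcos_mult[OF \<sigma>.hom_closed[OF ef(1)] \<sigma>.hom_closed[OF ef(2)]]
        a(3) b(3) ef by simp
    then have "\<exists>e\<in>?K. ?\<pi> (a \<otimes> b) = ?\<pi> (\<sigma> e)" using K.m_closed[OF a(2) b(2)] by (rule bexI)
    then show "a \<otimes> b \<in> ?E" using a(1) b(1) by simp
  qed
  then have "?K \<subseteq> ?E"
  proof (rule commutator_subgroup_leI)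
    fix h k assume h: "h \<in> ?R" "k \<in> carrier G"
    then have "comm G h k \<in> carrier G" using R.mem_carrier[OF h(1)] by simp
    then show "comm G h k \<in> ?E" using gen[OF h] by simp
  qed
  then obtain e where e: "e \<in> ?K" "?\<pi> d = ?\<pi> (\<sigma> e)" using d by auto
  have "d \<otimes> inv \<sigma> e \<in> ?S"
    using e(2) by (rule iffD1[OF rcos_eq_iff[OF S.subgroup_axioms K.mem_carrier[OF d]
      \<sigma>.hom_closed[OF K.mem_carrier[OF e(1)]]]])
  then show ?thesis using e(1) by (rule bexI)
qed

theorem theorem2p4:
  fixes N :: "('a, 'b) monoid_scheme" and \<sigma> :: "'a \<Rightarrow> 'a"
  assumes "group N"
    and "torsion_free_group N"
    and "nilpotent_group N"
    and "finite_pruefer_rank N"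
    and "\<sigma> \<in> hom N N"
    and "(\<sigma> ` carrier N) <#>\<^bsub>N\<^esub> isolator2 N = carrier N"
  shows "\<sigma> \<in> iso N N"
proof -
  interpret group N by fact
  interpret \<sigma>: group_hom N N \<sigma> using assms(5) by (simp add: group_hom_def group_hom_axioms_def)
  obtain r where rank: "pruefer_rank_le N r" using assms(4) finite_pruefer_rank_iff by blast
  let ?R = "isolated_central N" and ?K = "\<lambda>i. commutator_subgroup N (isolated_central N i) (carrier N)"
  interpret R1: normal "?R (Suc 0)" N by (rule isolated_central_normal)
  have bij0: "endo_bij_mod \<sigma> (?R 0)"
    unfolding endo_bij_mod_def by (intro conjI ballI impI bexI[of _ "\<one>\<^bsub>N\<^esub>"]) simp_all
  have dense: "\<exists>e\<in>carrier N. d \<otimes>\<^bsub>N\<^esub> inv\<^bsub>N\<^esub> \<sigma> e \<in> ?R (Suc 0)" if d: "d \<in> carrier N" for d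
  proof -
    have "d \<in> (\<sigma> ` carrier N) <#>\<^bsub>N\<^esub> isolator2 N" unfolding assms(6) by (rule d)
    then obtain e g where e: "e \<in> carrier N" and g: "g \<in> isolator2 N" and de: "d = \<sigma> e \<otimes>\<^bsub>N\<^esub> g"
      unfolding set_mult_def by auto
    have "g \<in> ?R (Suc 0)" using g by (rule subsetD[OF isolator2_subset_isolated_central])
    \<comment> \<open>After substituting for \<open>d\<close> this element is the conjugate of
      \<open>g\<close> by \<open>\<sigma> e\<close>.\<close>
    then have "d \<otimes>\<^bsub>N\<^esub> inv\<^bsub>N\<^esub> \<sigma> e \<in> ?R (Suc 0)"
      unfolding de by (rule R1.inv_op_closed2[OF \<sigma>.hom_closed[OF e]])
    then show ?thesis using e by (rule bexI)
  qed
  \<comment> \<open>First stage with \<open>D\<close> the whole group: the torsion condition holds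
    with exponent 1, and \<open>dense\<close> is the condition on preimages.\<close>
  have bij1: "endo_bij_mod \<sigma> (?R (Suc 0))"
  proof (rule endo_bij_mod_isolated_central_Suc[OF rank assms(5), of "carrier N"])
    show "\<exists>m>0. x [^]\<^bsub>N\<^esub> (m::nat) \<in> carrier N" if "x \<in> ?R 0" for x
      using that by (intro exI[of _ 1]) simp
    show "\<sigma> ` carrier N \<subseteq> carrier N" by auto
    show "carrier N \<subseteq> ?R 0" by simp
  qed (fact bij0 dense subgroup_self)+
  \<comment> \<open>Two consecutive stages are carried along because the commutator argument uses
    bijectivity modulo both terms.\<close>
  have all: "endo_bij_mod \<sigma> (?R i) \<and> endo_bij_mod \<sigma> (?R (Suc i))" for i
  proof (induction i)
    case 0
    show ?case using bij0 bij1 by simp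
  next
    case (Suc i)
    interpret R: normal "?R i" N by (rule isolated_central_normal)
    have "endo_bij_mod \<sigma> (?R (Suc (Suc i)))"
    proof (rule endo_bij_mod_isolated_central_Suc[OF rank assms(5), of "?K i"])
      show "subgroup (?K i) N"
        by (rule normal_imp_subgroup[OF commutator_subgroup_normal[OF R.normal_axioms]])
      show "\<sigma> ` ?K i \<subseteq> ?K i"
        by (rule commutator_subgroup_endo[OF assms(5) R.subset isolated_central_endo[OF assms(5)]])
      show "\<exists>e\<in>?K i. d \<otimes>\<^bsub>N\<^esub> inv\<^bsub>N\<^esub> \<sigma> e \<in> ?R (Suc (Suc i))" if "d \<in> ?K i" for d
        using assms(5) Suc[THEN conjunct1] Suc[THEN conjunct2] that
        by (rule commutator_subgroup_isolated_central_fixed)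
      show "\<exists>m>0. x [^]\<^bsub>N\<^esub> (m::nat) \<in> ?K i" if "x \<in> ?R (Suc i)" for x
        using that by (simp add: isolated_central.simps)
    qed (fact commutator_subgroup_isolated_central_le Suc[THEN conjunct2])+
    then show ?case using Suc by simp
  qed
  obtain c where c: "?R c = {\<one>\<^bsub>N\<^esub>}"
  proof -
    obtain c where c: "lower_central N c = {\<one>\<^bsub>N\<^esub>}" using assms(3) unfolding nilpotent_group_def by auto
    interpret Z: normal "upper_central N c" N by (rule upper_central_normal)
    interpret R: normal "?R c" N by (rule isolated_central_normal)
    have "carrier N \<subseteq> upper_central N c" using lower_central_le_upper_central[OF c, of c] by simp
    then have "upper_central N c = carrier N" using Z.subset by (rule equalityI[rotated])
    then have "?R c \<subseteq> {\<one>\<^bsub>N\<^esub>}" using isolated_central_le_upper_central[OF assms(2), of c c] by simp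
    then have "?R c = {\<one>\<^bsub>N\<^esub>}" using R.one_closed by auto
    then show thesis by (rule that)
  qed
  \<comment> \<open>Modulo the trivial subgroup the statement is bijectivity of
    \<open>\<sigma>\<close> itself.\<close>
  have bij: "endo_bij_mod \<sigma> {\<one>\<^bsub>N\<^esub>}" using conjunct1[OF all[of c]] unfolding c .
  have "x \<in> \<sigma> ` carrier N" if x: "x \<in> carrier N" for x
  proof -
    obtain y where y: "y \<in> carrier N" "x \<otimes>\<^bsub>N\<^esub> inv\<^bsub>N\<^esub> \<sigma> y = \<one>\<^bsub>N\<^esub>"
      using endo_bij_mod_surj[OF bij x] by auto
    then have "x = \<sigma> y" using x inv_equality[of x "inv\<^bsub>N\<^esub> \<sigma> y"] by simp
    then show ?thesis using y(1) by simp
  qed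
  then have "carrier N \<subseteq> \<sigma> ` carrier N" by (rule subsetI)
  moreover have "\<forall>x\<in>carrier N. \<sigma> x = \<one>\<^bsub>N\<^esub> \<longrightarrow> x = \<one>\<^bsub>N\<^esub>"
    using endo_bij_mod_inj[OF bij] by simp
  ultimately show ?thesis unfolding \<sigma>.iso_iff by simp
qed

end
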